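(* Let $g_1, g_2$ be independent centred stationary Gaussian processes on $\mathbb{R}$ with covariance kernels $K_i(t) = \mathbb{E}[g_i(0) g_i(t)]$, $i=1,2$. Suppose that for each $i = 1,2$: $g_i$ is not identically zero; $g_i$ is almost surely $C^2$-smooth; and $K_i(t)\log|t| \to 0$ as $|t| \to \infty$. Let $f : \mathbb{R}^2 \to \mathbb{R}$ be the Gaussian field $f(x_1,x_2) = g_1(x_1) + g_2(x_2)$. Then the box-crossing estimates $$0 < \liminf_{R \to \infty} \mathbb{P}(\mathrm{Cross}_0(R, \rho R)) \le \limsup_{R \to \infty} \mathbb{P}(\mathrm{Cross}_0(R, \rho R)) < 1 \qquad \text{for every } \rho > 0$$ hold if and only if $K_1(0) = K_2(0)$. If $K_1(0) \neq K_2(0)$ then instead, for every $\rho > 0$, as $R \to \infty$, $$\mathbb{P}(\mathrm{Cross}_0(R, \rho R)) \to \begin{cases} 1 & \text{if } K_1(0) < K_2(0), \\ 0 & \text{if } K_2(0) < K_1(0). \end{cases}$$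
   Context: For $\ell \in \mathbb{R}$ and $a, b > 0$, $\mathrm{Cross}_\ell(a,b)$ denotes the event that there is a left-right path in $\{f \le \ell\} \cap ([0,a] \times [0,b])$, i.e. a (continuous) path contained in this set that intersects both $\{0\} \times [0,b]$ and $\{a\} \times [0,b]$. Here $\{f \le \ell\} = \{x \in \mathbb{R}^2 : f(x) \le \ell\}$. *)

theory Defs
  imports "HOL-Probability.Probability"
begin

text \<open>Gaussian random variables include the degenerate (almost surely constant) ones.\<close>

definition gaussian_rv :: "'w measure \<Rightarrow> ('w \<Rightarrow> real) \<Rightarrow> bool" where
  "gaussian_rv M X \<longleftrightarrow> X \<in> borel_measurable M \<and>
     (\<exists>\<mu>. (AE \<omega> in M. X \<omega> = \<mu>) \<or>
          (\<exists>\<sigma>>0. distributed M lborel X (\<lambda>x. ennreal (normal_density \<mu> \<sigma> x))))"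

definition gaussian_process :: "'w measure \<Rightarrow> (real \<Rightarrow> 'w \<Rightarrow> real) \<Rightarrow> bool" where
  "gaussian_process M g \<longleftrightarrow>
     (\<forall>T c. finite T \<longrightarrow> gaussian_rv M (\<lambda>\<omega>. \<Sum>t\<in>T. c t * g t \<omega>))"

definition centred :: "'w measure \<Rightarrow> (real \<Rightarrow> 'w \<Rightarrow> real) \<Rightarrow> bool" where
  "centred M g \<longleftrightarrow> (\<forall>t. prob_space.expectation M (g t) = 0)"

abbreviation path_space :: "(real \<Rightarrow> real) measure" where
  "path_space \<equiv> (\<Pi>\<^sub>M t\<in>UNIV. borel)"

text \<open>Equality of laws on the product sigma-algebra amounts to equality of all
  finite-dimensional distributions.\<close>

definition process_law :: "'w measure \<Rightarrow> (real \<Rightarrow> 'w \<Rightarrow> real) \<Rightarrow> (real \<Rightarrow> real) measure" where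
  "process_law M g = distr M path_space (\<lambda>\<omega> t. g t \<omega>)"

definition stationary :: "'w measure \<Rightarrow> (real \<Rightarrow> 'w \<Rightarrow> real) \<Rightarrow> bool" where
  "stationary M g \<longleftrightarrow> (\<forall>s. process_law M (\<lambda>t. g (t + s)) = process_law M g)"

definition indep_processes ::
    "'w measure \<Rightarrow> (real \<Rightarrow> 'w \<Rightarrow> real) \<Rightarrow> (real \<Rightarrow> 'w \<Rightarrow> real) \<Rightarrow> bool" where
  "indep_processes M g h \<longleftrightarrow>
     prob_space.indep_var M path_space (\<lambda>\<omega> t. g t \<omega>) path_space (\<lambda>\<omega> t. h t \<omega>)"

definition cov_kernel :: "'w measure \<Rightarrow> (real \<Rightarrow> 'w \<Rightarrow> real) \<Rightarrow> real \<Rightarrow> real" where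
  "cov_kernel M g t = prob_space.expectation M (\<lambda>\<omega>. g 0 \<omega> * g t \<omega>)"

definition C2_smooth :: "(real \<Rightarrow> real) \<Rightarrow> bool" where
  "C2_smooth h \<longleftrightarrow> (\<exists>h' h''. (\<forall>t. (h has_real_derivative h' t) (at t)) \<and>
     (\<forall>t. (h' has_real_derivative h'' t) (at t)) \<and> continuous_on UNIV h'')"

definition has_crossing :: "(real \<times> real \<Rightarrow> real) \<Rightarrow> real \<Rightarrow> real \<Rightarrow> real \<Rightarrow> bool" where
  "has_crossing u l a b \<longleftrightarrow>
     (\<exists>p. path p \<and> path_image p \<subseteq> {x. u x \<le> l} \<inter> ({0..a} \<times> {0..b}) \<and>
          path_image p \<inter> ({0} \<times> {0..b}) \<noteq> {} \<and>
          path_image p \<inter> ({a} \<times> {0..b}) \<noteq> {})"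

definition Cross ::
    "'w measure \<Rightarrow> (real \<times> real \<Rightarrow> 'w \<Rightarrow> real) \<Rightarrow> real \<Rightarrow> real \<Rightarrow> real \<Rightarrow> 'w set" where
  "Cross M f l a b = {\<omega> \<in> space M. has_crossing (\<lambda>x. f x \<omega>) l a b}"

text \<open>The completion is needed because crossing is a property of the whole sample path, and
  the sample paths are continuous only almost surely: the crossing event agrees with a
  measurable set up to a null set but need not itself lie in the sigma-algebra of \<open>M\<close>
  (and \<open>measure M\<close> is 0 outside it).\<close>

definition cross_prob ::
    "'w measure \<Rightarrow> (real \<times> real \<Rightarrow> 'w \<Rightarrow> real) \<Rightarrow> real \<Rightarrow> real \<Rightarrow> real \<Rightarrow> real" where
  "cross_prob M f l a b = measure (completion M) (Cross M f l a b)"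

definition sum_field ::
    "(real \<Rightarrow> 'w \<Rightarrow> real) \<Rightarrow> (real \<Rightarrow> 'w \<Rightarrow> real) \<Rightarrow> real \<times> real \<Rightarrow> 'w \<Rightarrow> real" where
  "sum_field g1 g2 x \<omega> = g1 (fst x) \<omega> + g2 (snd x) \<omega>"

end

theory Submission
  imports Defs "HOL-Real_Asymp.Real_Asymp"
begin

text \<open>An additive field has a left-right crossing of its sublevel set at \<open>0\<close> exactly when some
horizontal segment is such a crossing: a crossing path passes over a point where \<open>g1\<close> is maximal
on \<open>[0, a]\<close>, and the whole horizontal line through that point of the path lies in the sublevel
set. Hence the crossing event says that the maximum of \<open>g1\<close> over \<open>[0, R]\<close> is at most the maximum
of \<open>-g2\<close> over \<open>[0, \<rho> R]\<close>, and these are maxima of two independent stationary Gaussian processes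
(\<open>not_crossing_iff_rational_level\<close>, \<open>cross_prob_bounds\<close>).

For a process \<open>X\<close> normalised to unit variance, the probability that \<open>X\<close> exceeds \<open>v\<close> on an
interval of length \<open>R\<close> is governed by \<open>y = R exp (-v\<^sup>2 / 2)\<close>, the order of the mean number of
excursions above \<open>v\<close>. It is at most a constant times \<open>(R + 1) exp (-v\<^sup>2 / 2)\<close>
(\<open>prob_exceeds_le\<close>, by chaining over intervals of length \<open>1 / v\<close>, the natural scale of an
excursion), and for large \<open>v\<close> it is at least \<open>y / (C + (1 + \<epsilon>) y)\<close> (\<open>prob_exceeds_ge\<close>, by the
second moment method on a grid of mesh \<open>1 / v\<close>). Both bounds rest on the fact that \<open>1 - r t\<close>,
with \<open>r\<close> the correlation, is squeezed between two multiples of \<open>t\<^sup>2\<close> near \<open>0\<close>. The logarithmic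
decay of the covariance enters the second moment: at distances beyond \<open>exp (v\<^sup>2 / 8)\<close> it forces
\<open>r t v\<^sup>2\<close> to vanish, and then two exceedances of \<open>v\<close> are asymptotically independent.

If the variances agree, a common level with \<open>R exp (-v\<^sup>2 / 2)\<close> equal to a small constant is
exceeded by either maximum with probability bounded away from \<open>0\<close>, and stays above either maximum
with probability bounded away from \<open>0\<close>; by independence each of the two orders of the maxima has
probability bounded below (\<open>eventually_balanced_level\<close>). If the standard deviations differ, the
level \<open>\<kappa> sqrt (2 ln R)\<close> with \<open>\<kappa>\<close> strictly between them separates the two maxima with probability
tending to \<open>1\<close> (\<open>eventually_separating_level\<close>).\<close>

section \<open>Tails of the standard normal law\<close>

definition gauss_tail :: "real \<Rightarrow> real" where
  "gauss_tail x = measure std_normal_distribution {x<..}"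

interpretation std_normal: real_distribution std_normal_distribution
  by (rule real_dist_normal_dist)

lemma gauss_tail_nonneg: "0 \<le> gauss_tail x"
  by (simp add: gauss_tail_def)

lemma gauss_tail_antimono: "x \<le> y \<Longrightarrow> gauss_tail y \<le> gauss_tail x"
  unfolding gauss_tail_def by (intro std_normal.finite_measure_mono) auto

lemma std_normal_density_antimono:
  "0 \<le> x \<Longrightarrow> x \<le> y \<Longrightarrow> std_normal_density y \<le> std_normal_density x"
  by (auto simp: std_normal_density_def intro!: divide_right_mono power_mono)

lemma std_normal_density_le: "std_normal_density x \<le> exp (- x\<^sup>2 / 2)"
proof -
  have "1 \<le> sqrt (2 * pi)" using pi_gt3 by simp
  then show ?thesis by (simp add: std_normal_density_def divide_simps)
qed

lemma std_normal_interval: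
  fixes a b :: real
  assumes "0 \<le> a" "a \<le> b"
  shows "std_normal_density b * (b - a) \<le> measure std_normal_distribution {a<..b}"
    and "measure std_normal_distribution {a<..b} \<le> std_normal_density a * (b - a)"
proof -
  have e: "emeasure std_normal_distribution {a<..b} =
      (\<integral>\<^sup>+x. ennreal (std_normal_density x) * indicator {a<..b} x \<partial>lborel)"
    by (subst emeasure_density) auto
  have "(\<integral>\<^sup>+x. ennreal (std_normal_density b) * indicator {a<..b} x \<partial>lborel) \<le>
      emeasure std_normal_distribution {a<..b}"
    unfolding e using assms
    by (intro nn_integral_mono) (auto split: split_indicator intro!: ennreal_leI std_normal_density_antimono)
  then have "ennreal (std_normal_density b * (b - a)) \<le> measure std_normal_distribution {a<..b}"
    using assms by (simp add: nn_integral_cmult_indicator ennreal_mult' std_normal.emeasure_eq_measure)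
  then show "std_normal_density b * (b - a) \<le> measure std_normal_distribution {a<..b}"
    by (simp add: ennreal_le_iff)
  have "emeasure std_normal_distribution {a<..b} \<le>
      (\<integral>\<^sup>+x. ennreal (std_normal_density a) * indicator {a<..b} x \<partial>lborel)"
    unfolding e using assms
    by (intro nn_integral_mono) (auto split: split_indicator intro!: ennreal_leI std_normal_density_antimono)
  then have "ennreal (measure std_normal_distribution {a<..b}) \<le> ennreal (std_normal_density a * (b - a))"
    using assms by (simp add: nn_integral_cmult_indicator ennreal_mult' std_normal.emeasure_eq_measure)
  then show "measure std_normal_distribution {a<..b} \<le> std_normal_density a * (b - a)"
    using assms by (subst (asm) ennreal_le_iff) auto
qed

lemma gauss_tail_split:
  assumes "a \<le> b"
  shows "gauss_tail a = measure std_normal_distribution {a<..b} + gauss_tail b"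
  unfolding gauss_tail_def using assms
  by (subst std_normal.finite_measure_Union[symmetric]) (auto simp: ivl_disj_un)

lemma gauss_tail_le:
  assumes "0 < x"
  shows "gauss_tail x \<le> std_normal_density x / x"
proof -
  \<comment> \<open>On the tail the factor \<open>y / x \<ge> 1\<close> makes the density integrable in closed form.\<close>
  have D: "((\<lambda>y. - std_normal_density y / x) has_real_derivative y * std_normal_density y / x) (at y)" for y
    unfolding std_normal_density_def
    using assms by (auto intro!: derivative_eq_intros simp: field_simps)
  have "((\<lambda>y::real. - (1 / sqrt (2 * pi) * exp (- y\<^sup>2 / 2)) / x) \<longlongrightarrow> 0) at_top"
    using assms by real_asymp
  then have L: "((\<lambda>y. - std_normal_density y / x) \<longlongrightarrow> 0) at_top"
    by (simp add: std_normal_density_def)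
  have "emeasure std_normal_distribution {x<..} =
      (\<integral>\<^sup>+y. ennreal (std_normal_density y) * indicator {x<..} y \<partial>lborel)"
    by (subst emeasure_density) auto
  also have "\<dots> \<le> (\<integral>\<^sup>+y. ennreal (y * std_normal_density y / x) * indicator {x..} y \<partial>lborel)"
    using assms by (intro nn_integral_mono)
      (auto split: split_indicator intro!: ennreal_leI simp: field_simps mult_right_mono)
  also have "\<dots> = ennreal (0 - (- std_normal_density x / x))"
    by (rule nn_integral_FTC_atLeast[OF _ D _ L]) (use assms in auto)
  finally have "ennreal (gauss_tail x) \<le> ennreal (std_normal_density x / x)"
    by (simp add: std_normal.emeasure_eq_measure gauss_tail_def)
  then show ?thesis
    using assms by (subst (asm) ennreal_le_iff) auto
qed

lemma gauss_tail_le_exp: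
  assumes "1 \<le> x"
  shows "gauss_tail x \<le> exp (- x\<^sup>2 / 2)"
proof -
  have "gauss_tail x \<le> std_normal_density x / x" using assms by (intro gauss_tail_le) auto
  also have "\<dots> \<le> std_normal_density x / 1" using assms by (intro divide_left_mono) auto
  finally show ?thesis using std_normal_density_le[of x] by simp
qed

text \<open>The matching lower bound for the tail: already the interval from \<open>x\<close> to \<open>x + 1 / x\<close>, on which
the density drops only by a bounded factor, carries mass of order \<open>\<phi> x / x\<close>.\<close>

lemma std_normal_density_le_gauss_tail:
  assumes "1 \<le> x"
  shows "std_normal_density x \<le> exp (3/2) * (x * gauss_tail x)"
proof -
  let ?b = "x + 1 / x"
  have "?b\<^sup>2 = x\<^sup>2 + 2 + 1 / x\<^sup>2" using assms by (simp add: field_simps power2_eq_square)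
  moreover have "1 / x\<^sup>2 \<le> 1" using assms by (simp add: one_le_power)
  ultimately have "exp (-(3/2)) * exp (- x\<^sup>2 / 2) \<le> exp (- ?b\<^sup>2 / 2)"
    by (simp add: mult_exp_exp)
  then have "exp (-(3/2)) * std_normal_density x \<le> std_normal_density ?b"
    unfolding std_normal_density_def by (simp add: divide_right_mono)
  also have "std_normal_density ?b * (1 / x) \<le> gauss_tail x"
    using std_normal_interval(1)[of x ?b] gauss_tail_split[of x ?b] gauss_tail_nonneg[of ?b] assms
    by simp
  then have "std_normal_density ?b \<le> x * gauss_tail x"
    using assms by (simp add: field_simps)
  finally have "exp (3/2) * (exp (-(3/2)) * std_normal_density x) \<le> exp (3/2) * (x * gauss_tail x)"
    by (rule mult_left_mono) simp
  then show ?thesis by (simp add: mult_exp_exp mult.assoc[symmetric])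
qed

lemma gauss_tail_pos: "1 \<le> x \<Longrightarrow> 0 < gauss_tail x"
proof -
  assume "1 \<le> x"
  then have "0 < exp (3/2) * (x * gauss_tail x)"
    using std_normal_density_le_gauss_tail[of x] normal_density_pos[of 1 0 x] by linarith
  with \<open>1 \<le> x\<close> show ?thesis by (simp add: zero_less_mult_iff)
qed

text \<open>Lowering the level \<open>u\<close> by \<open>d\<close> changes the tail only by a bounded factor as long as \<open>u d\<close> stays
bounded, and by a factor close to \<open>1\<close> when \<open>u d\<close> is small. Shifts of order \<open>1 / u\<close> are therefore
harmless in the chaining, and the shifts caused by weak correlation are asymptotically invisible.\<close>

lemma gauss_tail_shift:
  assumes "1 \<le> u" "0 \<le> d" "d \<le> u"
  shows "gauss_tail (u - d) \<le> gauss_tail u * (1 + exp (3/2) * (u * d) * exp (u * d))"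
proof -
  have "std_normal_density (u - d) \<le> std_normal_density u * exp (u * d)"
  proof -
    have "- (u - d)\<^sup>2 / 2 \<le> - u\<^sup>2 / 2 + u * d"
      using zero_le_power2[of d] by (simp add: power2_eq_square field_simps)
    then have "exp (- (u - d)\<^sup>2 / 2) \<le> exp (- u\<^sup>2 / 2) * exp (u * d)"
      by (simp add: mult_exp_exp)
    then show ?thesis by (simp add: std_normal_density_def divide_right_mono)
  qed
  also have "\<dots> \<le> exp (3/2) * (u * gauss_tail u) * exp (u * d)"
    using std_normal_density_le_gauss_tail[OF assms(1)] by (intro mult_right_mono) auto
  finally have "std_normal_density (u - d) * d \<le> exp (3/2) * (u * gauss_tail u) * exp (u * d) * d"
    using assms by (intro mult_right_mono) auto
  moreover have "gauss_tail (u - d) \<le> std_normal_density (u - d) * d + gauss_tail u"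
    using gauss_tail_split[of "u - d" u] std_normal_interval(2)[of "u - d" u] assms by simp
  ultimately show ?thesis by (simp add: algebra_simps)
qed

lemma gauss_tail_ratio:
  assumes "1 \<le> u" "u \<le> v"
  shows "gauss_tail v \<le> exp (3/2) * gauss_tail u * exp (- (v\<^sup>2 - u\<^sup>2) / 2)"
proof -
  have "gauss_tail v \<le> std_normal_density v / v" using assms by (intro gauss_tail_le) auto
  also have "\<dots> \<le> std_normal_density v / u" using assms by (intro divide_left_mono) auto
  also have "std_normal_density v = std_normal_density u * exp (- (v\<^sup>2 - u\<^sup>2) / 2)"
    by (simp add: std_normal_density_def mult_exp_exp field_simps)
  also have "std_normal_density u * exp (- (v\<^sup>2 - u\<^sup>2) / 2) / u
      \<le> exp (3/2) * (u * gauss_tail u) * exp (- (v\<^sup>2 - u\<^sup>2) / 2) / u"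
    using std_normal_density_le_gauss_tail[of u] assms by (intro divide_right_mono mult_right_mono) auto
  finally show ?thesis using assms by simp
qed

section \<open>Independence of uncorrelated normal variables\<close>

text \<open>Uniqueness of characteristic functions on the line, for the measure with density \<open>w\<close>. Applying it
with weights that are functions of a second variable turns one-dimensional uniqueness into a
statement on joint laws.\<close>

lemma (in prob_space) weighted_law_std_normal:
  fixes U w :: "'a \<Rightarrow> real"
  assumes U [measurable]: "U \<in> borel_measurable M" and w [measurable]: "w \<in> borel_measurable M"
    and w_nonneg: "\<And>\<omega>. 0 \<le> w \<omega>" and w_le: "\<And>\<omega>. w \<omega> \<le> B"
    and char_w: "\<And>a. (CLINT \<omega>|M. complex_of_real (w \<omega>) * iexp (a * U \<omega>)) = complex_of_real (c * exp (- a\<^sup>2 / 2))"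
    and A [measurable]: "A \<in> sets borel"
  shows "(\<integral>\<omega>. w \<omega> * indicator A (U \<omega>) \<partial>M) = c * measure std_normal_distribution A"
proof -
  have int_w: "integrable M w"
    using w_nonneg w_le by (intro integrable_const_bound[of _ B]) auto
  have "complex_of_real (\<integral>\<omega>. w \<omega> \<partial>M) = (CLINT \<omega>|M. complex_of_real (w \<omega>) * iexp (0 * U \<omega>))"
    by simp
  also have "\<dots> = complex_of_real c"
    unfolding char_w by simp
  finally have c: "(\<integral>\<omega>. w \<omega> \<partial>M) = c" by simp
  have "0 \<le> c" unfolding c[symmetric] using w_nonneg by simp
  show ?thesis
  proof (cases "c = 0")
    \<comment> \<open>A weight of mean zero vanishes almost surely and cannot be normalised.\<close>
    case True
    with c have "AE \<omega> in M. w \<omega> = 0"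
      using integral_nonneg_eq_0_iff_AE[OF int_w] w_nonneg by auto
    then have "AE \<omega> in M. w \<omega> * indicator A (U \<omega>) = 0" by auto
    then have "(\<integral>\<omega>. w \<omega> * indicator A (U \<omega>) \<partial>M) = 0"
      by (subst integral_cong_AE[where g = "\<lambda>_. 0"]) auto
    with True show ?thesis by simp
  next
    case False
    with \<open>0 \<le> c\<close> have "0 < c" by simp
    define N where "N = density M (\<lambda>\<omega>. ennreal (w \<omega> / c))"
    have [measurable]: "U \<in> borel_measurable N" unfolding N_def by simp
    have "emeasure N (space N) = (\<integral>\<^sup>+\<omega>. ennreal (w \<omega> / c) \<partial>M)"
      unfolding N_def by (simp add: emeasure_density cong: nn_integral_cong)
    also have "\<dots> = ennreal (\<integral>\<omega>. w \<omega> / c \<partial>M)"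
      using int_w w_nonneg \<open>0 < c\<close> by (intro nn_integral_eq_integral) auto
    also have "\<dots> = 1" using c \<open>0 < c\<close> by simp
    finally interpret N: prob_space N by (rule prob_spaceI)
    have "char (distr N borel U) = char std_normal_distribution"
    proof
      fix a
      have "char (distr N borel U) a = (CLINT \<omega>|N. iexp (a * U \<omega>))"
        unfolding char_def by (subst integral_distr) auto
      also have "\<dots> = (CLINT \<omega>|M. (w \<omega> / c) *\<^sub>R iexp (a * U \<omega>))"
        unfolding N_def using w_nonneg \<open>0 < c\<close> by (subst integral_density) auto
      also have "\<dots> = (CLINT \<omega>|M. complex_of_real (1 / c) * (complex_of_real (w \<omega>) * iexp (a * U \<omega>)))"
        by (intro Bochner_Integration.integral_cong) (auto simp: scaleR_conv_of_real)
      also have "\<dots> = complex_of_real (1 / c) * complex_of_real (c * exp (- a\<^sup>2 / 2))"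
        by (subst integral_mult_right_zero) (simp only: char_w)
      also have "\<dots> = complex_of_real (exp (- a\<^sup>2 / 2))" using \<open>0 < c\<close> by simp
      finally show "char (distr N borel U) a = char std_normal_distribution a"
        by (simp add: char_std_normal_distribution)
    qed
    then have law: "distr N borel U = std_normal_distribution"
      by (intro Levy_uniqueness N.real_distribution_distr real_dist_normal_dist) auto
    have "measure std_normal_distribution A = (\<integral>x. indicator A x \<partial>distr N borel U)"
      unfolding law by simp
    also have "\<dots> = (\<integral>\<omega>. indicator A (U \<omega>) \<partial>N)"
      by (subst integral_distr) auto
    also have "\<dots> = (\<integral>\<omega>. (w \<omega> / c) *\<^sub>R indicator A (U \<omega>) \<partial>M)"
      unfolding N_def using w_nonneg \<open>0 < c\<close> by (subst integral_density) auto
    also have "\<dots> = (\<integral>\<omega>. w \<omega> * indicator A (U \<omega>) \<partial>M) / c"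
      by (simp add: mult.commute mult.left_commute divide_simps flip: integral_divide_zero)
    finally show ?thesis using \<open>0 < c\<close> by (simp add: field_simps)
  qed
qed

lemma (in prob_space) law_std_normal:
  fixes U :: "'a \<Rightarrow> real"
  assumes U [measurable]: "U \<in> borel_measurable M"
    and "\<And>a. (CLINT \<omega>|M. iexp (a * U \<omega>)) = complex_of_real (exp (- a\<^sup>2 / 2))"
  shows "prob {\<omega> \<in> space M. U \<omega> > x} = gauss_tail x"
proof -
  have "prob {\<omega> \<in> space M. U \<omega> > x} = (\<integral>\<omega>. 1 * indicator {x<..} (U \<omega>) \<partial>M)"
    by (subst Bochner_Integration.integral_cong[where g = "indicator {\<omega> \<in> space M. U \<omega> > x}"])
       (auto simp: indicator_def)
  also have "\<dots> = 1 * measure std_normal_distribution {x<..}"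
    by (rule weighted_law_std_normal[where B = 1]) (use assms in auto)
  finally show ?thesis by (simp add: gauss_tail_def)
qed

lemma (in prob_space) integrable_bounded_weight_iexp:
  fixes w U :: "'a \<Rightarrow> real"
  assumes [measurable]: "w \<in> borel_measurable M" "U \<in> borel_measurable M"
    and "\<And>\<omega>. \<bar>w \<omega>\<bar> \<le> B"
  shows "integrable M (\<lambda>\<omega>. complex_of_real (w \<omega>) * iexp (U \<omega>))"
  by (intro integrable_const_bound[of _ B]) (use assms(3) in \<open>auto simp: norm_mult\<close>)

text \<open>The weights \<open>1 + cos (b V)\<close> and \<open>1 + sin (b V)\<close> are nonnegative, and the joint characteristic
function shows that under each of them \<open>U\<close> is still normal. So the trigonometric moments of \<open>V\<close>
on the event \<open>U > x\<close> are those of a standard normal variable, scaled by the probability of the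
event; using the indicator of this event as the weight then identifies the law of \<open>V\<close> on it.\<close>

lemma (in prob_space) uncorrelated_std_normal_indep:
  fixes U V :: "'a \<Rightarrow> real"
  assumes U [measurable]: "U \<in> borel_measurable M" and V [measurable]: "V \<in> borel_measurable M"
    and char_UV: "\<And>a b. (CLINT \<omega>|M. iexp (a * U \<omega> + b * V \<omega>)) = complex_of_real (exp (- (a\<^sup>2 + b\<^sup>2) / 2))"
  shows "prob {\<omega> \<in> space M. U \<omega> > x \<and> V \<omega> > y} = gauss_tail x * gauss_tail y"
proof -
  let ?e = "\<lambda>b::real. exp (- b\<^sup>2 / 2)"
  have one_plus_cos_bounds: "0 \<le> 1 + cos z" "1 + cos z \<le> 2" for z :: real
    using cos_ge_minus_one[of z] cos_le_one[of z] by linarith+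
  have one_plus_sin_bounds: "0 \<le> 1 + sin z" "1 + sin z \<le> 2" for z :: real
    using sin_ge_minus_one[of z] sin_le_one[of z] by linarith+
  define P where "P = measure std_normal_distribution {x<..}"
  have plain: "(CLINT \<omega>|M. iexp (a * U \<omega>)) = complex_of_real (?e a)" for a
    using char_UV[of a 0] by simp
  have int: "integrable M (\<lambda>\<omega>. iexp (a * U \<omega> + b * V \<omega>))" for a b
    using integrable_bounded_weight_iexp[of "\<lambda>_. 1" "\<lambda>\<omega>. a * U \<omega> + b * V \<omega>" 1] by simp
  have int': "integrable M (\<lambda>\<omega>. iexp (a * U \<omega>))" for a
    using int[of a 0] by simp
  have tcos: "(\<integral>\<omega>. cos (b * V \<omega>) * indicator {x<..} (U \<omega>) \<partial>M) = ?e b * P" for b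
  proof -
    have "(CLINT \<omega>|M. complex_of_real (1 + cos (b * V \<omega>)) * iexp (a * U \<omega>))
        = complex_of_real ((1 + ?e b) * ?e a)" for a
    proof -
      have "complex_of_real (1 + cos (b * V \<omega>)) * iexp (a * U \<omega>) =
          iexp (a * U \<omega>) + (iexp (a * U \<omega> + b * V \<omega>) + iexp (a * U \<omega> + (- b) * V \<omega>)) / 2" for \<omega>
        by (simp add: cos_exp_eq cos_of_real[symmetric] exp_add exp_diff exp_minus field_simps)
      then have "(CLINT \<omega>|M. complex_of_real (1 + cos (b * V \<omega>)) * iexp (a * U \<omega>)) =
          (CLINT \<omega>|M. iexp (a * U \<omega>)) +
          ((CLINT \<omega>|M. iexp (a * U \<omega> + b * V \<omega>)) + (CLINT \<omega>|M. iexp (a * U \<omega> + (- b) * V \<omega>))) / 2"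
        using int[of a b] int[of a "-b"] int'[of a] by (simp del: of_real_add of_real_mult mult_minus_left)
      also have "\<dots> = complex_of_real (?e a + exp (- (a\<^sup>2 + b\<^sup>2) / 2))"
        unfolding char_UV plain by simp
      also have "exp (- (a\<^sup>2 + b\<^sup>2) / 2) = ?e b * ?e a" by (simp add: mult_exp_exp field_simps)
      finally show ?thesis by (simp add: algebra_simps)
    qed
    then have "(\<integral>\<omega>. (1 + cos (b * V \<omega>)) * indicator {x<..} (U \<omega>) \<partial>M) = (1 + ?e b) * P"
      unfolding P_def
      by (intro weighted_law_std_normal[where B = 2])
         (auto simp: one_plus_cos_bounds)
    moreover have "(\<integral>\<omega>. 1 * indicator {x<..} (U \<omega>) \<partial>M) = 1 * P"
      unfolding P_def by (rule weighted_law_std_normal[where B = 1]) (use plain in auto)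
    moreover have "(\<integral>\<omega>. (1 + cos (b * V \<omega>)) * indicator {x<..} (U \<omega>) \<partial>M) =
        (\<integral>\<omega>. 1 * indicator {x<..} (U \<omega>) \<partial>M) + (\<integral>\<omega>. cos (b * V \<omega>) * indicator {x<..} (U \<omega>) \<partial>M)"
      unfolding distrib_right
      by (intro Bochner_Integration.integral_add integrable_const_bound[of _ 1])
         (auto simp: indicator_def abs_mult)
    ultimately show ?thesis by (simp add: algebra_simps)
  qed
  have tsin: "(\<integral>\<omega>. sin (b * V \<omega>) * indicator {x<..} (U \<omega>) \<partial>M) = 0" for b
  proof -
    have "(CLINT \<omega>|M. complex_of_real (1 + sin (b * V \<omega>)) * iexp (a * U \<omega>))
        = complex_of_real (1 * ?e a)" for a
    proof -
      have "complex_of_real (1 + sin (b * V \<omega>)) * iexp (a * U \<omega>) =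
          iexp (a * U \<omega>) + (iexp (a * U \<omega> + b * V \<omega>) - iexp (a * U \<omega> + (- b) * V \<omega>)) / (2 * \<i>)" for \<omega>
        by (simp add: sin_exp_eq sin_of_real[symmetric] exp_add exp_diff exp_minus field_simps)
      then have "(CLINT \<omega>|M. complex_of_real (1 + sin (b * V \<omega>)) * iexp (a * U \<omega>)) =
          (CLINT \<omega>|M. iexp (a * U \<omega>)) +
          ((CLINT \<omega>|M. iexp (a * U \<omega> + b * V \<omega>)) - (CLINT \<omega>|M. iexp (a * U \<omega> + (- b) * V \<omega>))) / (2 * \<i>)"
        using int[of a b] int[of a "-b"] int'[of a] by (simp del: of_real_add of_real_mult mult_minus_left)
      also have "\<dots> = complex_of_real (?e a)"
        unfolding char_UV plain by simp
      finally show ?thesis by simp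
    qed
    then have "(\<integral>\<omega>. (1 + sin (b * V \<omega>)) * indicator {x<..} (U \<omega>) \<partial>M) = 1 * P"
      unfolding P_def
      by (intro weighted_law_std_normal[where B = 2])
         (auto simp: one_plus_sin_bounds)
    moreover have "(\<integral>\<omega>. 1 * indicator {x<..} (U \<omega>) \<partial>M) = 1 * P"
      unfolding P_def by (rule weighted_law_std_normal[where B = 1]) (use plain in auto)
    moreover have "(\<integral>\<omega>. (1 + sin (b * V \<omega>)) * indicator {x<..} (U \<omega>) \<partial>M) =
        (\<integral>\<omega>. 1 * indicator {x<..} (U \<omega>) \<partial>M) + (\<integral>\<omega>. sin (b * V \<omega>) * indicator {x<..} (U \<omega>) \<partial>M)"
      unfolding distrib_right
      by (intro Bochner_Integration.integral_add integrable_const_bound[of _ 1])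
         (auto simp: indicator_def abs_mult)
    ultimately show ?thesis by simp
  qed
  have "(CLINT \<omega>|M. complex_of_real (indicator {x<..} (U \<omega>)) * iexp (b * V \<omega>))
      = complex_of_real (P * ?e b)" for b
  proof -
    let ?I = "\<lambda>\<omega>. indicator {x<..} (U \<omega>) :: real"
    have i1: "integrable M (\<lambda>\<omega>. complex_of_real (cos (b * V \<omega>) * ?I \<omega>))"
      by (intro integrable_const_bound[of _ 1]) (auto simp: indicator_def norm_mult)
    have i2: "integrable M (\<lambda>\<omega>. complex_of_real (sin (b * V \<omega>) * ?I \<omega>))"
      by (intro integrable_const_bound[of _ 1]) (auto simp: indicator_def norm_mult)
    have "complex_of_real (?I \<omega>) * iexp (b * V \<omega>) =
        complex_of_real (cos (b * V \<omega>) * ?I \<omega>) + \<i> * complex_of_real (sin (b * V \<omega>) * ?I \<omega>)" for \<omega>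
      unfolding cis_conv_exp[symmetric] by (simp add: cis.ctr complex_eq_iff mult.commute)
    then have "(CLINT \<omega>|M. complex_of_real (?I \<omega>) * iexp (b * V \<omega>)) =
        (CLINT \<omega>|M. complex_of_real (cos (b * V \<omega>) * ?I \<omega>)) + 
        \<i> * (CLINT \<omega>|M. complex_of_real (sin (b * V \<omega>) * ?I \<omega>))"
      using i1 i2 by (simp del: of_real_mult)
    also have "\<dots> = complex_of_real (P * ?e b)"
      unfolding integral_complex_of_real tcos tsin by (simp add: mult.commute)
    finally show ?thesis .
  qed
  then have "(\<integral>\<omega>. indicator {x<..} (U \<omega>) * indicator {y<..} (V \<omega>) \<partial>M) = P * measure std_normal_distribution {y<..}"
    by (intro weighted_law_std_normal[where B = 1]) (auto simp: indicator_def)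
  moreover have "prob {\<omega> \<in> space M. U \<omega> > x \<and> V \<omega> > y} = (\<integral>\<omega>. indicator {x<..} (U \<omega>) * indicator {y<..} (V \<omega>) \<partial>M)"
    by (subst Bochner_Integration.integral_cong[where g = "indicator {\<omega> \<in> space M. U \<omega> > x \<and> V \<omega> > y}"])
       (auto simp: indicator_def)
  ultimately show ?thesis by (simp add: P_def gauss_tail_def)
qed

section \<open>The correlation of a smooth normalised process\<close>

lemma (in prob_space) expectation_iexp_tendsto:
  fixes Y :: "nat \<Rightarrow> 'a \<Rightarrow> real"
  assumes [measurable]: "\<And>n. Y n \<in> borel_measurable M" "Z \<in> borel_measurable M"
    and lim: "AE \<omega> in M. (\<lambda>n. Y n \<omega>) \<longlonglongrightarrow> Z \<omega>"
  shows "(\<lambda>n. CLINT \<omega>|M. iexp (Y n \<omega>)) \<longlonglongrightarrow> (CLINT \<omega>|M. iexp (Z \<omega>))"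
proof (rule integral_dominated_convergence[where w = "\<lambda>_. 1"])
  show "AE \<omega> in M. (\<lambda>n. iexp (Y n \<omega>)) \<longlonglongrightarrow> iexp (Z \<omega>)"
    using lim by eventually_elim (rule tendsto_exp[OF tendsto_mult_left[OF tendsto_of_real]])
qed (auto simp del: of_real_mult)

text \<open>Joint normality of pairs is recorded by characteristic functions, a form that covers degenerate
pairs such as \<open>X t = - X s\<close> as well. Stationarity is contained in the fact that \<open>r\<close> depends on
the time difference only.\<close>

locale unit_gaussian_process = prob_space M for M :: "'w measure" +
  fixes X :: "real \<Rightarrow> 'w \<Rightarrow> real" and r :: "real \<Rightarrow> real"
  assumes measurable_X [measurable]: "X t \<in> borel_measurable M"
    and char_pair: "(CLINT \<omega>|M. iexp (a * X s \<omega> + b * X t \<omega>)) =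
      complex_of_real (exp (- (a\<^sup>2 + b\<^sup>2 + 2 * a * b * r (t - s)) / 2))"
    and integrable_cov: "integrable M (\<lambda>\<omega>. X s \<omega> * X t \<omega>)"
    and cov: "expectation (\<lambda>\<omega>. X s \<omega> * X t \<omega>) = r (t - s)"
    and continuous_paths: "AE \<omega> in M. continuous_on UNIV (\<lambda>t. X t \<omega>)"
    and differentiable_paths: "AE \<omega> in M. \<exists>d. ((\<lambda>t. X t \<omega>) has_real_derivative d) (at 0)"
    and decay: "((\<lambda>t. r t * ln \<bar>t\<bar>) \<longlongrightarrow> 0) at_infinity"
begin

lemma r_0: "r 0 = 1"
proof -
  have "complex_of_real 1 = complex_of_real (exp (- (1\<^sup>2 + (-1)\<^sup>2 + 2 * 1 * (-1) * r (0 - 0)) / 2))"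
    unfolding char_pair[symmetric] by (simp add: prob_space)
  then have "1 = exp (- (1\<^sup>2 + (-1)\<^sup>2 + 2 * 1 * (-1) * r (0 - 0)) / 2)"
    unfolding of_real_eq_iff .
  then have "- (1\<^sup>2 + (-1)\<^sup>2 + 2 * 1 * (-1) * r (0 - 0)) / 2 = 0"
    using exp_eq_one_iff by metis
  then show ?thesis by simp
qed

lemma r_minus: "r (- t) = r t"
  using cov[of 0 t] cov[of t 0] by (simp add: mult.commute)

lemma r_abs_arg: "r \<bar>t\<bar> = r t"
  by (cases "t \<ge> 0") (auto simp: r_minus)

lemma integral_lincomb_sq:
  "integrable M (\<lambda>\<omega>. (a * X s \<omega> + b * X t \<omega>)\<^sup>2)"
  "expectation (\<lambda>\<omega>. (a * X s \<omega> + b * X t \<omega>)\<^sup>2) = a\<^sup>2 + b\<^sup>2 + 2 * a * b * r (t - s)"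
proof -
  have eq: "(a * X s \<omega> + b * X t \<omega>)\<^sup>2 = a\<^sup>2 * (X s \<omega> * X s \<omega>) + b\<^sup>2 * (X t \<omega> * X t \<omega>)
      + 2 * a * b * (X s \<omega> * X t \<omega>)" for \<omega>
    by (simp add: power2_eq_square algebra_simps)
  show "integrable M (\<lambda>\<omega>. (a * X s \<omega> + b * X t \<omega>)\<^sup>2)"
    unfolding eq using integrable_cov by simp
  show "expectation (\<lambda>\<omega>. (a * X s \<omega> + b * X t \<omega>)\<^sup>2) = a\<^sup>2 + b\<^sup>2 + 2 * a * b * r (t - s)"
    unfolding eq using integrable_cov by (simp add: cov r_0)
qed

lemma abs_r_le_1: "\<bar>r t\<bar> \<le> 1"
proof -
  have "0 \<le> expectation (\<lambda>\<omega>. (1 * X 0 \<omega> + b * X t \<omega>)\<^sup>2)" for b by simp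
  from this[of 1] this[of "-1"] show ?thesis
    unfolding integral_lincomb_sq(2) by auto
qed

lemma prob_gt: "prob {\<omega> \<in> space M. X t \<omega> > x} = gauss_tail x"
  using char_pair[of _ t 0 t] by (intro law_std_normal) auto

lemma prob_sum_gt:
  assumes "r (t - s) > -1"
  shows "prob {\<omega> \<in> space M. X s \<omega> + X t \<omega> > x} = gauss_tail (x / sqrt (2 * (1 + r (t - s))))"
proof -
  define c where "c = sqrt (2 * (1 + r (t - s)))"
  have c: "0 < c" "c\<^sup>2 = 2 * (1 + r (t - s))" using assms by (auto simp: c_def)
  have "prob {\<omega> \<in> space M. (X s \<omega> + X t \<omega>) / c > x / c} = gauss_tail (x / c)"
  proof (rule law_std_normal)
    fix a
    have "(CLINT \<omega>|M. iexp (a * ((X s \<omega> + X t \<omega>) / c))) = (CLINT \<omega>|M. iexp (a / c * X s \<omega> + a / c * X t \<omega>))"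
      by (simp add: algebra_simps add_divide_distrib)
    also have "\<dots> = complex_of_real (exp (- ((a / c)\<^sup>2 + (a / c)\<^sup>2 + 2 * (a / c) * (a / c) * r (t - s)) / 2))"
      by (rule char_pair)
    also have "(a / c)\<^sup>2 + (a / c)\<^sup>2 + 2 * (a / c) * (a / c) * r (t - s) = a\<^sup>2 * (2 * (1 + r (t - s))) / c\<^sup>2"
      by (simp add: power2_eq_square algebra_simps add_divide_distrib)
    also have "\<dots> = a\<^sup>2" unfolding c(2)[symmetric] using c(1) by simp
    finally show "(CLINT \<omega>|M. iexp (a * ((X s \<omega> + X t \<omega>) / c))) = complex_of_real (exp (- a\<^sup>2 / 2))" .
  qed simp
  then show ?thesis using c by (simp add: divide_less_cancel c_def)
qed

text \<open>Regression of \<open>X t\<close> on \<open>X s\<close>: the normalised residual is independent of \<open>X s\<close>. The sign \<open>e\<close>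
makes the statement available for deviations of the residual in both directions.\<close>

lemma prob_pair_indep:
  assumes "\<bar>r (t - s)\<bar> < 1" and e: "e\<^sup>2 = 1"
  shows "prob {\<omega> \<in> space M. X s \<omega> > x \<and> e * (X t \<omega> - r (t - s) * X s \<omega>) / sqrt (1 - (r (t - s))\<^sup>2) > y}
     = gauss_tail x * gauss_tail y"
proof (rule uncorrelated_std_normal_indep)
  define q where "q = r (t - s)"
  define c where "c = sqrt (1 - q\<^sup>2)"
  have "q\<^sup>2 < 1" using assms(1) by (simp add: q_def abs_square_less_1)
  then have c: "0 < c" "c\<^sup>2 = 1 - q\<^sup>2" by (auto simp: c_def)
  fix a b
  have "(CLINT \<omega>|M. iexp (a * X s \<omega> + b * (e * (X t \<omega> - q * X s \<omega>) / c))) =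
      (CLINT \<omega>|M. iexp ((a - b * e * q / c) * X s \<omega> + (b * e / c) * X t \<omega>))"
    using c(1) by (intro Bochner_Integration.integral_cong refl arg_cong[where f = iexp])
      (simp add: field_simps)
  also have "\<dots> = complex_of_real (exp (- ((a - b * e * q / c)\<^sup>2 + (b * e / c)\<^sup>2
      + 2 * (a - b * e * q / c) * (b * e / c) * q) / 2))"
    unfolding q_def by (rule char_pair)
  also have "(a - b * e * q / c)\<^sup>2 + (b * e / c)\<^sup>2 + 2 * (a - b * e * q / c) * (b * e / c) * q
      = a\<^sup>2 + b\<^sup>2 * e\<^sup>2 * (1 - q\<^sup>2) / c\<^sup>2"
    using c(1) by (simp add: power2_eq_square field_simps)
  also have "\<dots> = a\<^sup>2 + b\<^sup>2" unfolding c(2)[symmetric] e using c(1) by simp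
  finally show "(CLINT \<omega>|M. iexp (a * X s \<omega> + b * (e * (X t \<omega> - r (t - s) * X s \<omega>) / sqrt (1 - (r (t - s))\<^sup>2)))) =
      complex_of_real (exp (- (a\<^sup>2 + b\<^sup>2) / 2))"
    by (simp add: q_def c_def)
qed simp_all

text \<open>Up to the factor \<open>2\<close>, \<open>1 - r\<close> is the squared \<open>L\<^sup>2\<close> distance between two values of the process, and
the distance over \<open>n\<close> steps is at most \<open>n\<close> times the distance over one step.\<close>

lemma one_minus_r_multiple: "1 - r (real n * t) \<le> (real n)\<^sup>2 * (1 - r t)"
proof -
  define D where "D i \<omega> = 1 * X (real (Suc i) * t) \<omega> + (-1) * X (real i * t) \<omega>" for i \<omega>
  have D: "integrable M (\<lambda>\<omega>. (D i \<omega>)\<^sup>2)" "expectation (\<lambda>\<omega>. (D i \<omega>)\<^sup>2) = 2 * (1 - r t)" for i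
    unfolding D_def integral_lincomb_sq(2)
    by (rule integral_lincomb_sq(1)) (simp add: algebra_simps r_minus)
  have tele: "1 * X (real n * t) \<omega> + (-1) * X 0 \<omega> = (\<Sum>i<n. D i \<omega>)" for \<omega>
    using sum_lessThan_telescope[of "\<lambda>i. X (real i * t) \<omega>" n] by (simp add: D_def)
  have "2 * (1 - r (real n * t)) = expectation (\<lambda>\<omega>. (1 * X (real n * t) \<omega> + (-1) * X 0 \<omega>)\<^sup>2)"
    unfolding integral_lincomb_sq by (simp add: r_minus)
  also have "\<dots> \<le> expectation (\<lambda>\<omega>. real n * (\<Sum>i<n. (D i \<omega>)\<^sup>2))"
  proof (rule integral_mono)
    show "integrable M (\<lambda>\<omega>. (1 * X (real n * t) \<omega> + (-1) * X 0 \<omega>)\<^sup>2)"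
      by (rule integral_lincomb_sq)
    show "integrable M (\<lambda>\<omega>. real n * (\<Sum>i<n. (D i \<omega>)\<^sup>2))" using D by simp
    show "(1 * X (real n * t) \<omega> + (-1) * X 0 \<omega>)\<^sup>2 \<le> real n * (\<Sum>i<n. (D i \<omega>)\<^sup>2)" for \<omega>
      unfolding tele using sum_squared_le_sum_of_squares[of "\<lambda>i. D i \<omega>" "{..<n}"]
      by (simp add: mult.commute)
  qed
  also have "\<dots> = real n * (real n * (2 * (1 - r t)))" using D by simp
  also have "\<dots> = 2 * ((real n)\<^sup>2 * (1 - r t))" by (simp add: power2_eq_square)
  finally show ?thesis by (rule mult_left_le_imp_le) simp
qed

lemma tendsto_r: "(r \<longlongrightarrow> 0) at_infinity"
proof (rule Lim_null_comparison[OF _ tendsto_rabs_zero[OF decay]])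
  have "1 \<le> ln \<bar>t\<bar>" if "exp 1 \<le> norm t" for t :: real
    using that less_le_trans[OF exp_gt_zero that] by (subst ln_ge_iff) auto
  then have "norm (r t) \<le> \<bar>r t * ln \<bar>t\<bar>\<bar>" if "exp 1 \<le> norm t" for t
    using that by (simp add: abs_mult) (metis abs_ge_zero abs_ge_self mult_left_mono mult.right_neutral order_trans)
  then show "\<forall>\<^sub>F t in at_infinity. norm (r t) \<le> \<bar>r t * ln \<bar>t\<bar>\<bar>"
    unfolding eventually_at_infinity by blast
qed

text \<open>A small step \<open>t\<close> can be repeated about \<open>s0 / t\<close> times to reach times beyond \<open>s0\<close>, where the
correlation is small by the decay assumption; the subadditivity of the \<open>L\<^sup>2\<close> distance then bounds
\<open>1 - r t\<close> from below by a multiple of \<open>t\<^sup>2\<close>.\<close>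

lemma ex_nondegeneracy:
  obtains s0 c where "0 < s0" "0 < c" "\<And>t. s0 \<le> \<bar>t\<bar> \<Longrightarrow> \<bar>r t\<bar> \<le> 1 / 12"
    "\<And>t. \<bar>t\<bar> < s0 \<Longrightarrow> c * t\<^sup>2 \<le> 1 - r t"
proof -
  have "\<forall>\<^sub>F t in at_infinity. dist (r t) 0 < 1 / 12"
    using tendsto_r by (rule tendstoD) simp
  then obtain b where b: "\<And>t. b \<le> norm t \<Longrightarrow> \<bar>r t\<bar> < 1 / 12"
    unfolding eventually_at_infinity by auto
  define s0 where "s0 = max b 1"
  have s0: "0 < s0" "\<And>t. s0 \<le> \<bar>t\<bar> \<Longrightarrow> \<bar>r t\<bar> \<le> 1 / 12"
    using b by (auto simp: s0_def intro!: less_imp_le)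
  have pos: "1 / (8 * s0\<^sup>2) * t\<^sup>2 \<le> 1 - r t" if t: "0 < t" "t < s0" for t
  proof -
    define m where "m = nat \<lceil>s0 / t\<rceil>"
    have "s0 / t \<le> real m" unfolding m_def by linarith
    then have m1: "s0 \<le> real m * t" using t by (simp add: field_simps)
    have "1 \<le> s0 / t" using t by simp
    then have "real m \<le> s0 / t + 1" unfolding m_def by linarith
    with \<open>1 \<le> s0 / t\<close> have m2: "real m \<le> 2 * (s0 / t)" by linarith
    have "1 / 2 \<le> 1 - r (real m * t)"
      using s0(2)[OF order_trans[OF m1 abs_ge_self]] by (simp add: abs_le_iff)
    also have "\<dots> \<le> (real m)\<^sup>2 * (1 - r t)" by (rule one_minus_r_multiple)
    also have "\<dots> \<le> (2 * (s0 / t))\<^sup>2 * (1 - r t)"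
      using m2 abs_r_le_1[of t] by (intro mult_right_mono power_mono) auto
    finally show ?thesis using t s0(1) by (simp add: field_simps power2_eq_square)
  qed
  have "1 / (8 * s0\<^sup>2) * t\<^sup>2 \<le> 1 - r t" if "\<bar>t\<bar> < s0" for t
    using pos[of "\<bar>t\<bar>"] that by (cases "t = 0") (auto simp: r_0 r_abs_arg)
  then show thesis using s0 by (intro that[of s0 "1 / (8 * s0\<^sup>2)"]) auto
qed

text \<open>If the bound failed, difference quotients at \<open>0\<close> along some null sequence would have variances
tending to infinity, so their characteristic functions would tend to \<open>0\<close> away from the origin. But
the quotients converge almost surely, so the limit is a characteristic function, which is
continuous with value \<open>1\<close> at the origin.\<close>

lemma ex_quadratic_bound:
  obtains t0 C where "0 < t0" "0 < C" "\<And>t. \<bar>t\<bar> \<le> t0 \<Longrightarrow> 1 - r t \<le> C * t\<^sup>2"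
proof (rule ccontr)
  assume "\<not> thesis"
  with that have no: "\<not> (\<forall>t. \<bar>t\<bar> \<le> t0 \<longrightarrow> 1 - r t \<le> C * t\<^sup>2)" if "0 < t0" "0 < C" for t0 C
    using that by blast
  have "\<exists>t. \<bar>t\<bar> \<le> 1 / real (Suc n) \<and> real (Suc n) * t\<^sup>2 < 1 - r t" for n
    using no[of "1 / real (Suc n)" "real (Suc n)"] by (auto simp: not_le)
  then obtain t where t: "\<And>n. \<bar>t n\<bar> \<le> 1 / real (Suc n)" "\<And>n. real (Suc n) * (t n)\<^sup>2 < 1 - r (t n)"
    by metis
  have t_nz: "t n \<noteq> 0" for n
  proof
    assume "t n = 0"
    with t(2)[of n] show False by (simp only: r_0) simp
  qed
  have "(\<lambda>n. 1 / real (Suc n)) \<longlonglongrightarrow> 0" using LIMSEQ_inverse_real_of_nat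
    by (simp only: inverse_eq_divide)
  then have "t \<longlonglongrightarrow> 0" 
    by (rule Lim_null_comparison[rotated]) (intro always_eventually allI, simp only: real_norm_def t(1))
  then have t_at: "filterlim t (at 0) sequentially" using t_nz by (simp add: filterlim_at)
  define D where "D n \<omega> = (X (t n) \<omega> - X 0 \<omega>) / t n" for n \<omega>
  have [measurable]: "D n \<in> borel_measurable M" for n unfolding D_def by simp
  define D' where "D' \<omega> = lim (\<lambda>n. D n \<omega>)" for \<omega>
  have [measurable]: "D' \<in> borel_measurable M" unfolding D'_def by measurable
  have conv: "AE \<omega> in M. (\<lambda>n. D n \<omega>) \<longlonglongrightarrow> D' \<omega>"
    using differentiable_paths
  proof eventually_elim
    case (elim \<omega>)
    then obtain d where "((\<lambda>t. X t \<omega>) has_real_derivative d) (at 0)" by blast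
    then have "((\<lambda>h. (X h \<omega> - X 0 \<omega>) / h) \<longlongrightarrow> d) (at 0)"
      by (simp add: has_field_derivative_iff)
    from filterlim_compose[OF this t_at] have "(\<lambda>n. D n \<omega>) \<longlonglongrightarrow> d" by (simp add: D_def)
    then show ?case unfolding D'_def by (simp add: limI)
  qed
  have zero: "(CLINT \<omega>|M. iexp (l * D' \<omega>)) = 0" if l: "l \<noteq> 0" for l :: real
  proof (rule LIMSEQ_unique)
    show "(\<lambda>n. CLINT \<omega>|M. iexp (l * D n \<omega>)) \<longlonglongrightarrow> (CLINT \<omega>|M. iexp (l * D' \<omega>))"
    proof (rule expectation_iexp_tendsto)
      show "AE \<omega> in M. (\<lambda>n. l * D n \<omega>) \<longlonglongrightarrow> l * D' \<omega>"
        using conv by eventually_elim (rule tendsto_mult_left)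
    qed measurable
    have char_D: "(CLINT \<omega>|M. iexp (l * D n \<omega>)) = complex_of_real (exp (- (l\<^sup>2 * ((1 - r (t n)) / (t n)\<^sup>2))))" for n
    proof -
      have D: "l * D n \<omega> = - l / t n * X 0 \<omega> + l / t n * X (t n) \<omega>" for \<omega>
        unfolding D_def using t_nz[of n] by (simp add: field_simps)
      have "(CLINT \<omega>|M. iexp (l * D n \<omega>)) = (CLINT \<omega>|M. iexp (- l / t n * X 0 \<omega> + l / t n * X (t n) \<omega>))"
        unfolding D ..
      also have "\<dots> = complex_of_real (exp (- ((- l / t n)\<^sup>2 + (l / t n)\<^sup>2 + 2 * (- l / t n) * (l / t n) * r (t n - 0)) / 2))"
        by (rule char_pair)
      also have "- ((- l / t n)\<^sup>2 + (l / t n)\<^sup>2 + 2 * (- l / t n) * (l / t n) * r (t n - 0)) / 2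
          = - (l\<^sup>2 * ((1 - r (t n)) / (t n)\<^sup>2))"
        using t_nz[of n] by (simp add: power2_eq_square field_simps)
      finally show ?thesis .
    qed
    have le: "exp (- (l\<^sup>2 * ((1 - r (t n)) / (t n)\<^sup>2))) \<le> exp (- (l\<^sup>2 * real (Suc n)))" for n
    proof -
      have "real (Suc n) \<le> (1 - r (t n)) / (t n)\<^sup>2"
        using t(2)[of n] t_nz[of n] by (simp add: pos_le_divide_eq del: of_nat_Suc)
      from mult_left_mono[OF this zero_le_power2[of l]] show ?thesis
        by (simp only: neg_le_iff_le exp_le_cancel_iff)
    qed
    have "(\<lambda>n. exp (- (l\<^sup>2 * real (Suc n)))) \<longlonglongrightarrow> 0"
    proof -
      have "0 < l\<^sup>2" using l by simp
      then have "filterlim (\<lambda>n. l\<^sup>2 * real (Suc n)) at_top sequentially"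
        by (rule filterlim_tendsto_pos_mult_at_top[OF tendsto_const])
          (rule filterlim_compose[OF filterlim_real_sequentially filterlim_Suc])
      then show ?thesis
        using filterlim_compose[OF exp_at_bot, of "\<lambda>n. - (l\<^sup>2 * real (Suc n))"]
        by (simp only: filterlim_uminus_at_bot minus_minus)
    qed
    then have "(\<lambda>n. exp (- (l\<^sup>2 * ((1 - r (t n)) / (t n)\<^sup>2)))) \<longlonglongrightarrow> 0"
      by (rule tendsto_sandwich[OF always_eventually always_eventually tendsto_const, rotated 2])
        (simp, rule allI, rule le)
    then show "(\<lambda>n. CLINT \<omega>|M. iexp (l * D n \<omega>)) \<longlonglongrightarrow> 0"
      unfolding char_D by (rule tendsto_of_real[where a = 0, unfolded of_real_0])
  qed
  have "(\<lambda>n. CLINT \<omega>|M. iexp (1 / real (Suc n) * D' \<omega>)) \<longlonglongrightarrow> (CLINT \<omega>|M. iexp (0 * D' \<omega>))"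
  proof (rule expectation_iexp_tendsto)
    show "AE \<omega> in M. (\<lambda>n. 1 / real (Suc n) * D' \<omega>) \<longlonglongrightarrow> 0 * D' \<omega>"
      using \<open>(\<lambda>n. 1 / real (Suc n)) \<longlonglongrightarrow> 0\<close> by (intro AE_I2 tendsto_mult_right)
  qed measurable
  moreover have "(\<lambda>n. CLINT \<omega>|M. iexp (1 / real (Suc n) * D' \<omega>)) = (\<lambda>n. 0)"
    by (intro ext zero) simp
  moreover have "(CLINT \<omega>|M. iexp (0 * D' \<omega>)) = 1" by (simp add: prob_space)
  ultimately have "(\<lambda>n::nat. 0 :: complex) \<longlonglongrightarrow> 1"
    by (simp only:)
  then show False by (simp add: LIMSEQ_const_iff)
qed

end

section \<open>Joint exceedances at two times\<close>

lemma eventually_gauss_tail_triple: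
  fixes \<epsilon> :: real
  assumes "0 < \<epsilon>"
  shows "\<forall>\<^sub>F u in at_top. gauss_tail (3 * u) \<le> \<epsilon> * (gauss_tail u)\<^sup>2"
proof -
  have "((\<lambda>u::real. exp 3 * sqrt (2 * pi) * u * exp (- 7 * u\<^sup>2 / 2)) \<longlongrightarrow> 0) at_top"
    by real_asymp
  then have "\<forall>\<^sub>F u in at_top. exp 3 * sqrt (2 * pi) * u * exp (- 7 * u\<^sup>2 / 2) < \<epsilon>"
    using assms by (rule order_tendstoD)
  then show ?thesis
    using eventually_ge_at_top[of 1]
  proof eventually_elim
    case (elim u)
    have "gauss_tail (3 * u) \<le> exp (3/2) * gauss_tail u * exp (- ((3 * u)\<^sup>2 - u\<^sup>2) / 2)"
      using elim by (intro gauss_tail_ratio) auto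
    also have "- ((3 * u)\<^sup>2 - u\<^sup>2) / 2 = - u\<^sup>2 / 2 + (- 7 * u\<^sup>2 / 2)" by (simp add: power2_eq_square)
    also have "exp (3/2) * gauss_tail u * exp (- u\<^sup>2 / 2 + (- 7 * u\<^sup>2 / 2))
        = exp (3/2) * gauss_tail u * exp (- 7 * u\<^sup>2 / 2) * sqrt (2 * pi) * std_normal_density u"
      unfolding exp_add by (simp add: std_normal_density_def)
    also have "\<dots> \<le> exp (3/2) * gauss_tail u * exp (- 7 * u\<^sup>2 / 2) * sqrt (2 * pi) * (exp (3/2) * (u * gauss_tail u))"
      using std_normal_density_le_gauss_tail[OF elim(2)] gauss_tail_nonneg[of u]
      by (intro mult_left_mono) auto
    also have "\<dots> = (exp (3/2) * exp (3/2) * sqrt (2 * pi) * u * exp (- 7 * u\<^sup>2 / 2)) * (gauss_tail u)\<^sup>2"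
      by (simp add: power2_eq_square)
    also have "exp (3/2) * exp (3/2) = exp (3::real)" by (simp add: mult_exp_exp)
    also have "(exp 3 * sqrt (2 * pi) * u * exp (- 7 * u\<^sup>2 / 2)) * (gauss_tail u)\<^sup>2 \<le> \<epsilon> * (gauss_tail u)\<^sup>2"
      using elim(1) by (intro mult_right_mono) auto
    finally show ?case .
  qed
qed

lemma sum_nat_dist_le:
  fixes g :: "nat \<Rightarrow> real"
  assumes "\<And>k. 0 \<le> g k" "i < n"
  shows "(\<Sum>j<n. g (max i j - min i j)) \<le> 2 * (\<Sum>k<n. g k)"
proof -
  have "(\<Sum>j<n. g (max i j - min i j)) = (\<Sum>j\<le>i. g (max i j - min i j)) + (\<Sum>j\<in>{i<..<n}. g (max i j - min i j))"
    using assms(2) by (subst sum.union_disjoint[symmetric]) (auto intro!: sum.cong)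
  also have "(\<Sum>j\<le>i. g (max i j - min i j)) = (\<Sum>k\<in>(\<lambda>j. i - j) ` {..i}. g k)"
    by (subst sum.reindex) (auto simp: inj_on_def max_absorb1 min_absorb2)
  also have "\<dots> \<le> (\<Sum>k<n. g k)" using assms by (intro sum_mono2) auto
  also have "(\<Sum>j\<in>{i<..<n}. g (max i j - min i j)) = (\<Sum>k\<in>(\<lambda>j. j - i) ` {i<..<n}. g k)"
    by (subst sum.reindex) (auto simp: inj_on_def max_absorb2 min_absorb1)
  also have "\<dots> \<le> (\<Sum>k<n. g k)" using assms by (intro sum_mono2) auto
  finally show ?thesis by simp
qed

context unit_gaussian_process
begin

text \<open>Unless \<open>X s\<close> is larger than \<open>3 u\<close>, which is much less likely than two independent exceedances of
\<open>u\<close>, its contribution to \<open>X t\<close> is at most \<open>3 \<bar>r\<bar> u\<close>, and the independent residual has to make up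
the rest.\<close>

lemma prob_pair_far:
  assumes u: "0 \<le> u" and r: "\<bar>r (t - s)\<bar> \<le> 1 / 3"
  shows "prob {\<omega> \<in> space M. X s \<omega> > u \<and> X t \<omega> > u}
    \<le> gauss_tail u * gauss_tail (u - 3 * \<bar>r (t - s)\<bar> * u) + gauss_tail (3 * u)"
proof -
  define q where "q = r (t - s)"
  define c where "c = sqrt (1 - q\<^sup>2)"
  have q: "\<bar>q\<bar> \<le> 1 / 3" using r by (simp add: q_def)
  then have "q\<^sup>2 < 1" by (simp add: abs_square_less_1)
  then have c: "0 < c" "c \<le> 1" by (auto simp: c_def)
  let ?A = "{\<omega> \<in> space M. X s \<omega> > u \<and> 1 * (X t \<omega> - q * X s \<omega>) / c > u - 3 * \<bar>q\<bar> * u}"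
  have "prob {\<omega> \<in> space M. X s \<omega> > u \<and> X t \<omega> > u} \<le> prob (?A \<union> {\<omega> \<in> space M. X s \<omega> > 3 * u})"
  proof (rule finite_measure_mono)
    show "{\<omega> \<in> space M. X s \<omega> > u \<and> X t \<omega> > u} \<subseteq> ?A \<union> {\<omega> \<in> space M. X s \<omega> > 3 * u}"
    proof
      fix \<omega> assume \<omega>: "\<omega> \<in> {\<omega> \<in> space M. X s \<omega> > u \<and> X t \<omega> > u}"
      show "\<omega> \<in> ?A \<union> {\<omega> \<in> space M. X s \<omega> > 3 * u}"
      proof (cases "X s \<omega> > 3 * u")
        case False
        have "q * X s \<omega> \<le> \<bar>q\<bar> * (3 * u)"
          using False \<omega> u by (intro mult_mono) auto
        then have gt: "u - 3 * \<bar>q\<bar> * u < X t \<omega> - q * X s \<omega>" using \<omega> by auto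
        have "3 * \<bar>q\<bar> * u \<le> 1 * u" using q u by (intro mult_right_mono) auto
        then have "X t \<omega> - q * X s \<omega> \<le> (X t \<omega> - q * X s \<omega>) / c"
          using c gt by (simp add: pos_le_divide_eq mult_left_le)
        with gt \<omega> show ?thesis by auto
      qed (use \<omega> in auto)
    qed
  qed simp
  also have "\<dots> \<le> prob ?A + prob {\<omega> \<in> space M. X s \<omega> > 3 * u}"
    by (intro measure_Un_le) auto
  also have "prob ?A = gauss_tail u * gauss_tail (u - 3 * \<bar>q\<bar> * u)"
    using prob_pair_indep[of t s 1 u "u - 3 * \<bar>q\<bar> * u"] q by (simp add: q_def c_def)
  finally show ?thesis by (simp add: prob_gt q_def)
qed

text \<open>Two exceedances of \<open>u\<close> force the sum to exceed \<open>2 u\<close>, and the variance of the sum is smaller than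
\<open>4\<close> by \<open>2 (1 - r)\<close>.\<close>

lemma prob_pair_near:
  assumes u: "1 \<le> u" and r: "-1 < r (t - s)"
  shows "prob {\<omega> \<in> space M. X s \<omega> > u \<and> X t \<omega> > u}
    \<le> exp (3/2) * gauss_tail u * exp (- u\<^sup>2 * (1 - r (t - s)) / 4)"
proof -
  define q where "q = r (t - s)"
  define v where "v = 2 * u / sqrt (2 * (1 + q))"
  have q: "-1 < q" "q \<le> 1" using r abs_r_le_1[of "t - s"] by (auto simp: q_def abs_le_iff)
  have v2: "v\<^sup>2 = 2 * u\<^sup>2 / (1 + q)"
    using q by (simp add: v_def power_divide power_mult_distrib field_simps)
  have "sqrt (2 * (1 + q)) \<le> sqrt (2\<^sup>2)" using q by (intro real_sqrt_le_mono) auto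
  then have "u \<le> v" using u q by (simp add: v_def pos_le_divide_eq)
  have "u\<^sup>2 * (1 - q) / 2 \<le> u\<^sup>2 * (1 - q) / (1 + q)"
    using q by (intro divide_left_mono) auto
  also have "\<dots> = v\<^sup>2 - u\<^sup>2" unfolding v2 using q by (simp add: field_simps)
  finally have diff: "- (v\<^sup>2 - u\<^sup>2) / 2 \<le> - u\<^sup>2 * (1 - q) / 4" by (simp add: field_simps)
  have "prob {\<omega> \<in> space M. X s \<omega> > u \<and> X t \<omega> > u} \<le> prob {\<omega> \<in> space M. X s \<omega> + X t \<omega> > 2 * u}"
    by (intro finite_measure_mono) auto
  also have "\<dots> = gauss_tail v"
    using prob_sum_gt[OF r] by (simp add: v_def q_def)
  also have "\<dots> \<le> exp (3/2) * gauss_tail u * exp (- (v\<^sup>2 - u\<^sup>2) / 2)"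
    using u \<open>u \<le> v\<close> by (rule gauss_tail_ratio)
  also have "\<dots> \<le> exp (3/2) * gauss_tail u * exp (- u\<^sup>2 * (1 - q) / 4)"
    using diff gauss_tail_nonneg[of u] by (intro mult_left_mono) auto
  finally show ?thesis by (simp add: q_def)
qed

text \<open>Three ranges of the distance between grid points are covered by the three summands. Below \<open>s0\<close> the
quadratic lower bound for \<open>1 - r\<close> gives geometric decay in the number of grid steps. Between \<open>s0\<close>
and \<open>exp (u\<^sup>2 / 8)\<close> the correlation is at most \<open>1 / 12\<close> and costs a factor that outweighs the number
of grid points in this range. Beyond \<open>exp (u\<^sup>2 / 8)\<close> the logarithmic decay makes the two exceedances
independent up to the factor \<open>1 + \<epsilon>\<close>.\<close>

lemma prob_pair_grid:
  obtains A q where "0 < A" "0 < q" "q < 1"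
    "\<And>\<epsilon>. 0 < \<epsilon> \<Longrightarrow> \<forall>\<^sub>F u in at_top. \<forall>i j :: nat.
      prob {\<omega> \<in> space M. X (real i / u) \<omega> > u \<and> X (real j / u) \<omega> > u} \<le>
        A * gauss_tail u * q ^ (max i j - min i j)
        + (if real (max i j - min i j) < u * exp (u\<^sup>2 / 8) then gauss_tail u * exp (- 9 * u\<^sup>2 / 32) else 0)
        + (1 + \<epsilon>) * (gauss_tail u)\<^sup>2"
proof -
  obtain s0 c where s0: "0 < s0" "0 < c" "\<And>t. s0 \<le> \<bar>t\<bar> \<Longrightarrow> \<bar>r t\<bar> \<le> 1 / 12"
    "\<And>t. \<bar>t\<bar> < s0 \<Longrightarrow> c * t\<^sup>2 \<le> 1 - r t"
    by (rule ex_nondegeneracy) blast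
  define q where "q = exp (- c / 4)"
  have q: "0 < q" "q < 1" using s0(2) by (auto simp: q_def)
  have q_pow: "exp (- c / 4 * (real k)\<^sup>2) \<le> q ^ k" for k :: nat
  proof -
    have "real k \<le> (real k)\<^sup>2" by (cases k) (auto simp: power2_eq_square)
    then have "- c / 4 * (real k)\<^sup>2 \<le> real k * (- c / 4)" using s0(2) by (simp add: mult.commute)
    then show ?thesis unfolding q_def exp_of_nat_mult[symmetric] by simp
  qed
  have "\<forall>\<^sub>F u in at_top. \<forall>i j :: nat.
      prob {\<omega> \<in> space M. X (real i / u) \<omega> > u \<and> X (real j / u) \<omega> > u} \<le>
        exp (3/2) * gauss_tail u * q ^ (max i j - min i j)
        + (if real (max i j - min i j) < u * exp (u\<^sup>2 / 8) then gauss_tail u * exp (- 9 * u\<^sup>2 / 32) else 0)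
        + (1 + \<epsilon>) * (gauss_tail u)\<^sup>2" if \<epsilon>: "0 < \<epsilon>" for \<epsilon>
  proof -
    \<comment> \<open>In the far range \<open>3 \<bar>r\<bar> u\<^sup>2 \<le> 24 \<bar>r t ln t\<bar>\<close>, whence the factor \<open>24\<close>.\<close>
    define \<delta> where "\<delta> = min (1 / 24) (\<epsilon> / (48 * exp (5/2)))"
    have \<delta>: "0 < \<delta>" "24 * \<delta> \<le> 1" "exp (5/2) * (24 * \<delta>) \<le> \<epsilon> / 2"
      using \<epsilon> by (auto simp: \<delta>_def min_def field_simps)
    have "\<forall>\<^sub>F t in at_infinity. dist (r t * ln \<bar>t\<bar>) 0 < \<delta>"
      using decay \<delta>(1) by (rule tendstoD)
    then obtain T where T: "\<And>t. T \<le> norm t \<Longrightarrow> \<bar>r t * ln \<bar>t\<bar>\<bar> < \<delta>"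
      unfolding eventually_at_infinity by auto
    have "\<forall>\<^sub>F u::real in at_top. T \<le> exp (u\<^sup>2 / 8)" by real_asymp
    moreover have "\<forall>\<^sub>F u::real in at_top. s0 \<le> exp (u\<^sup>2 / 8)" by real_asymp
    moreover have "\<forall>\<^sub>F u in at_top. gauss_tail (3 * u) \<le> \<epsilon> / 2 * (gauss_tail u)\<^sup>2"
      using \<epsilon> by (intro eventually_gauss_tail_triple) auto
    ultimately show ?thesis
      using eventually_ge_at_top[of 2]
    proof eventually_elim
      case (elim u)
      define p where "p = gauss_tail u"
      have p: "0 < p" using elim(4) by (auto simp: p_def intro: gauss_tail_pos)
      show ?case
      proof (intro allI)
        fix i j :: nat
        define k where "k = max i j - min i j"
        define s where "s = real i / u"
        define t where "t = real j / u"
        have abs_ts: "\<bar>t - s\<bar> = real k / u"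
          using elim(4) by (auto simp: s_def t_def k_def max_def min_def of_nat_diff field_simps abs_if)
        have pos: "0 \<le> exp (3/2) * p * q ^ k" "0 \<le> (1 + \<epsilon>) * p\<^sup>2" "0 \<le> p * exp (- 9 * u\<^sup>2 / 32)"
          using p q \<epsilon> by auto
        let ?P = "prob {\<omega> \<in> space M. X s \<omega> > u \<and> X t \<omega> > u}"
        consider "real k / u < s0" | "s0 \<le> real k / u" "real k / u < exp (u\<^sup>2 / 8)" | "exp (u\<^sup>2 / 8) \<le> real k / u"
          by linarith
        then have "?P \<le> exp (3/2) * p * q ^ k
          + (if real k < u * exp (u\<^sup>2 / 8) then p * exp (- 9 * u\<^sup>2 / 32) else 0) + (1 + \<epsilon>) * p\<^sup>2"
        proof cases
          case 1
          show ?thesis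
          proof (cases "-1 < r (t - s)")
            case True
            have "c * (real k / u)\<^sup>2 \<le> 1 - r (t - s)"
              using s0(4)[of "t - s"] 1 abs_ts by (metis power2_abs)
            then have "u\<^sup>2 * (c * (real k / u)\<^sup>2) \<le> u\<^sup>2 * (1 - r (t - s))" by (intro mult_left_mono) auto
            then have "- u\<^sup>2 * (1 - r (t - s)) / 4 \<le> - c / 4 * (real k)\<^sup>2"
              using elim(4) by (simp add: power_divide)
            then have "exp (- u\<^sup>2 * (1 - r (t - s)) / 4) \<le> q ^ k"
              using q_pow[of k] by (meson exp_le_cancel_iff order_trans)
            then have "exp (3/2) * p * exp (- u\<^sup>2 * (1 - r (t - s)) / 4) \<le> exp (3/2) * p * q ^ k"
              using p by (intro mult_left_mono) auto
            moreover have "?P \<le> exp (3/2) * p * exp (- u\<^sup>2 * (1 - r (t - s)) / 4)"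
              unfolding p_def by (rule prob_pair_near) (use True elim(4) in auto)
            ultimately have "?P \<le> exp (3/2) * p * q ^ k" by linarith
            then show ?thesis using pos by auto
          next
            case False
            \<comment> \<open>Here \<open>r = -1\<close>, so that \<open>X t = - X s\<close> and both cannot exceed a positive level.\<close>
            have "?P = 0"
            proof -
              have "r (t - s) = -1" using False abs_r_le_1[of "t - s"] by auto
              then have "expectation (\<lambda>\<omega>. (1 * X s \<omega> + 1 * X t \<omega>)\<^sup>2) = 0"
                by (simp only: integral_lincomb_sq) simp
              then have "AE \<omega> in M. (1 * X s \<omega> + 1 * X t \<omega>)\<^sup>2 = 0"
                by (subst (asm) integral_nonneg_eq_0_iff_AE[OF integral_lincomb_sq(1)]) auto
              then have "AE \<omega> in M. \<omega> \<notin> {\<omega> \<in> space M. X s \<omega> > u \<and> X t \<omega> > u}"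
                by (rule eventually_mono) (use elim(4) in auto)
              then show ?thesis by (subst prob_eq_0) auto
            qed
            then show ?thesis using pos by auto
          qed
        next
          case 2
          have r12: "\<bar>r (t - s)\<bar> \<le> 1 / 12" using s0(3)[of "t - s"] 2 abs_ts by auto
          have "?P \<le> p * gauss_tail (u - 3 * \<bar>r (t - s)\<bar> * u) + gauss_tail (3 * u)"
            unfolding p_def by (rule prob_pair_far) (use r12 elim(4) in auto)
          also have "gauss_tail (u - 3 * \<bar>r (t - s)\<bar> * u) \<le> gauss_tail (3 * u / 4)"
          proof (rule gauss_tail_antimono)
            have "3 * \<bar>r (t - s)\<bar> * u \<le> 1 / 4 * u" using r12 elim(4) by (intro mult_right_mono) auto
            then show "3 * u / 4 \<le> u - 3 * \<bar>r (t - s)\<bar> * u" by simp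
          qed
          also have "gauss_tail (3 * u / 4) \<le> exp (- (3 * u / 4)\<^sup>2 / 2)"
            using elim(4) by (intro gauss_tail_le_exp) auto
          also have "- (3 * u / 4)\<^sup>2 / 2 = - 9 * u\<^sup>2 / 32" by (simp add: power2_eq_square)
          finally have "?P \<le> p * exp (- 9 * u\<^sup>2 / 32) + \<epsilon> / 2 * p\<^sup>2"
            using p elim(3) by (simp add: p_def)
          moreover have "\<epsilon> / 2 * p\<^sup>2 \<le> (1 + \<epsilon>) * p\<^sup>2" using \<epsilon> by (intro mult_right_mono) auto
          moreover have "real k < u * exp (u\<^sup>2 / 8)" using 2 elim(4) by (simp add: field_simps)
          ultimately show ?thesis using pos by simp
        next
          case 3
          define e where "e = 3 * \<bar>r (t - s)\<bar> * u\<^sup>2"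
          have r12: "\<bar>r (t - s)\<bar> \<le> 1 / 12" using s0(3)[of "t - s"] 3 abs_ts elim(2) by auto
          have "u\<^sup>2 / 8 \<le> ln \<bar>t - s\<bar>"
            using 3 unfolding abs_ts by (subst ln_ge_iff) (auto intro: less_le_trans[OF exp_gt_zero])
          then have "\<bar>r (t - s)\<bar> * (u\<^sup>2 / 8) \<le> \<bar>r (t - s)\<bar> * ln \<bar>t - s\<bar>" by (intro mult_left_mono) auto
          also have "\<dots> \<le> \<bar>r (t - s) * ln \<bar>t - s\<bar>\<bar>" by (simp add: abs_mult mult_left_mono)
          also have "\<dots> < \<delta>" using T[of "t - s"] 3 abs_ts elim(1) by simp
          finally have e: "0 \<le> e" "e \<le> 24 * \<delta>" by (auto simp: e_def)
          have "gauss_tail (u - 3 * \<bar>r (t - s)\<bar> * u) \<le>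
              p * (1 + exp (3/2) * (u * (3 * \<bar>r (t - s)\<bar> * u)) * exp (u * (3 * \<bar>r (t - s)\<bar> * u)))"
            unfolding p_def
          proof (rule gauss_tail_shift)
            have "3 * \<bar>r (t - s)\<bar> * u \<le> 1 * u" using r12 elim(4) by (intro mult_right_mono) auto
            then show "3 * \<bar>r (t - s)\<bar> * u \<le> u" by simp
          qed (use elim(4) in auto)
          also have "u * (3 * \<bar>r (t - s)\<bar> * u) = e" by (simp add: e_def power2_eq_square)
          also have "exp (3/2) * e * exp e \<le> exp (3/2) * (24 * \<delta>) * exp 1"
            using e \<delta> by (intro mult_mono) auto
          also have "\<dots> = exp (5/2) * (24 * \<delta>)" by (simp add: mult_exp_exp)
          also have "\<dots> \<le> \<epsilon> / 2" by (rule \<delta>)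
          finally have "gauss_tail (u - 3 * \<bar>r (t - s)\<bar> * u) \<le> p * (1 + \<epsilon> / 2)"
            using p by simp
          then have "p * gauss_tail (u - 3 * \<bar>r (t - s)\<bar> * u) \<le> p * (p * (1 + \<epsilon> / 2))"
            using p by (intro mult_left_mono) auto
          moreover have "?P \<le> p * gauss_tail (u - 3 * \<bar>r (t - s)\<bar> * u) + gauss_tail (3 * u)"
            unfolding p_def by (rule prob_pair_far) (use r12 elim(4) in auto)
          ultimately have "?P \<le> p * (p * (1 + \<epsilon> / 2)) + \<epsilon> / 2 * p\<^sup>2"
            using elim(3) by (simp add: p_def)
          also have "\<dots> = (1 + \<epsilon>) * p\<^sup>2" by (simp add: power2_eq_square algebra_simps)
          finally show ?thesis using pos by auto
        qed
        then show "prob {\<omega> \<in> space M. X (real i / u) \<omega> > u \<and> X (real j / u) \<omega> > u} \<le>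
          exp (3/2) * gauss_tail u * q ^ (max i j - min i j)
          + (if real (max i j - min i j) < u * exp (u\<^sup>2 / 8) then gauss_tail u * exp (- 9 * u\<^sup>2 / 32) else 0)
          + (1 + \<epsilon>) * (gauss_tail u)\<^sup>2"
          by (simp only: p_def k_def s_def t_def)
      qed
    qed
  qed
  then show thesis using q by (intro that[of "exp (3/2)" q]) auto
qed

end

section \<open>Lower bound for exceedance probabilities\<close>

text \<open>Only rational times are inspected, so that the event is measurable although the paths are continuous
only almost surely.\<close>

definition exceeds :: "'w measure \<Rightarrow> (real \<Rightarrow> 'w \<Rightarrow> real) \<Rightarrow> real \<Rightarrow> real \<Rightarrow> 'w set" where
  "exceeds M Y u R = {\<omega> \<in> space M. \<exists>t\<in>{0..R} \<inter> \<rat>. Y t \<omega> > u}"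

lemma sets_exceeds:
  assumes [measurable]: "\<And>t. Y t \<in> borel_measurable M"
  shows "exceeds M Y u R \<in> sets M"
proof -
  have "exceeds M Y u R = (\<Union>t\<in>{0..R} \<inter> \<rat>. {\<omega> \<in> space M. Y t \<omega> > u})"
    by (auto simp: exceeds_def)
  moreover have "{\<omega> \<in> space M. Y t \<omega> > u} \<in> sets M" for t by measurable
  then have "(\<Union>t\<in>{0..R} \<inter> \<rat>. {\<omega> \<in> space M. Y t \<omega> > u}) \<in> sets M"
    by (rule sets.countable_UN''[OF countable_Int2[OF countable_rat]])
  ultimately show ?thesis by (simp only:)
qed

lemma continuous_exceeds_Rats:
  fixes h :: "real \<Rightarrow> real"
  assumes h: "continuous_on UNIV h" and R: "0 < R" and t: "t \<in> {0..R}" "h t > u"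
  shows "\<exists>q\<in>{0..R} \<inter> \<rat>. h q > u"
proof -
  have "open {x. h x > u}"
    by (rule open_Collect_less[OF continuous_on_const h])
  then obtain e where e: "0 < e" "ball t e \<subseteq> {x. h x > u}"
    using t(2) unfolding open_contains_ball by blast
  have "max 0 (t - e) < min R (t + e)" using e(1) R t(1) by auto
  then obtain q where "q \<in> \<rat>" "max 0 (t - e) < q" "q < min R (t + e)"
    using Rats_dense_in_real by blast
  moreover from calculation have "q \<in> ball t e" by (simp add: dist_real_def abs_less_iff)
  ultimately show ?thesis using e(2) by (intro bexI[of _ q]) auto
qed

lemma sum_geometric_le:
  fixes q :: real
  assumes "0 \<le> q" "q < 1"
  shows "(\<Sum>k<n. q ^ k) \<le> 1 / (1 - q)"
proof -
  have "(\<Sum>k<n. q ^ k) = (1 - q ^ n) / (1 - q)" using assms by (simp add: sum_gp_strict)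
  also have "\<dots> \<le> 1 / (1 - q)" using assms by (intro divide_right_mono) auto
  finally show ?thesis .
qed

lemma sum_if_less_le:
  fixes B e :: real
  assumes "0 \<le> B" "0 \<le> e"
  shows "(\<Sum>k<n. if real k < B then e else 0) \<le> (B + 1) * e"
proof -
  have "(\<Sum>k<n. if real k < B then e else 0) = real (card {k\<in>{..<n}. real k < B}) * e"
    by (subst sum.inter_filter[symmetric]) auto
  also have "card {k\<in>{..<n}. real k < B} \<le> card {..<nat \<lceil>B\<rceil>}"
  proof (rule card_mono)
    show "{k \<in> {..<n}. real k < B} \<subseteq> {..<nat \<lceil>B\<rceil>}"
    proof
      fix k assume "k \<in> {k \<in> {..<n}. real k < B}"
      then have "real k < B" by simp
      then show "k \<in> {..<nat \<lceil>B\<rceil>}" unfolding lessThan_iff by linarith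
    qed
  qed simp
  then have "card {k\<in>{..<n}. real k < B} \<le> nat \<lceil>B\<rceil>" by simp
  then have "real (card {k\<in>{..<n}. real k < B}) \<le> B + 1" using assms(1) by linarith
  then have "real (card {k\<in>{..<n}. real k < B}) * e \<le> (B + 1) * e" using assms(2) by (rule mult_right_mono)
  finally show ?thesis .
qed

text \<open>The indicator of the event \<open>N \<ge> 1\<close>, where \<open>N\<close> counts the events that occur, is at least
\<open>2 a N - a\<^sup>2 N\<^sup>2 = 1 - (1 - a N)\<^sup>2\<close> for every real \<open>a\<close>. Taking expectations and the optimal
\<open>a = m / S\<close> gives the bound.\<close>

lemma (in prob_space) prob_Union_second_moment:
  fixes E :: "nat \<Rightarrow> 'a set"
  assumes E [measurable]: "\<And>i. E i \<in> events" and S: "0 < S"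
    and sum2: "(\<Sum>i<n. \<Sum>j<n. prob (E i \<inter> E j)) \<le> S"
    and m: "m = (\<Sum>i<n. prob (E i))"
  shows "m\<^sup>2 / S \<le> prob (\<Union>i<n. E i)"
proof -
  define N :: "'a \<Rightarrow> real" where "N \<omega> = (\<Sum>i<n. indicator (E i) \<omega>)" for \<omega>
  define a where "a = m / S"
  have int_E: "integrable M (indicator (E i) :: 'a \<Rightarrow> real)" for i
    by (simp add: emeasure_eq_measure)
  have int_EE: "integrable M (indicator (E i \<inter> E j) :: 'a \<Rightarrow> real)" for i j
    by (simp add: emeasure_eq_measure)
  have N2: "(N \<omega>)\<^sup>2 = (\<Sum>i<n. \<Sum>j<n. indicator (E i \<inter> E j) \<omega>)" for \<omega>
    unfolding N_def power2_eq_square sum_product indicator_inter_arith ..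
  have int: "integrable M N" "integrable M (\<lambda>\<omega>. (N \<omega>)\<^sup>2)"
    unfolding N2 unfolding N_def by (intro Bochner_Integration.integrable_sum int_E int_EE)+
  have EN: "expectation N = m"
    unfolding N_def m by (simp only: Bochner_Integration.integral_sum int_E) simp
  have EN2: "expectation (\<lambda>\<omega>. (N \<omega>)\<^sup>2) \<le> S"
    unfolding N2
    by (simp only: Bochner_Integration.integral_sum Bochner_Integration.integrable_sum int_EE)
      (use sum2 in simp)
  have "m\<^sup>2 / S = 2 * a * m - a\<^sup>2 * S" using S by (simp add: a_def power2_eq_square)
  also have "\<dots> \<le> 2 * a * expectation N - a\<^sup>2 * expectation (\<lambda>\<omega>. (N \<omega>)\<^sup>2)"
    unfolding EN using EN2 by (simp add: mult_left_mono)
  also have "\<dots> = expectation (\<lambda>\<omega>. 2 * a * N \<omega> - a\<^sup>2 * (N \<omega>)\<^sup>2)"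
    using int by simp
  also have "\<dots> \<le> expectation (indicator (\<Union>i<n. E i))"
  proof (rule integral_mono)
    show "integrable M (\<lambda>\<omega>. 2 * a * N \<omega> - a\<^sup>2 * (N \<omega>)\<^sup>2)" using int by simp
    show "integrable M (indicator (\<Union>i<n. E i) :: 'a \<Rightarrow> real)" by (auto simp: emeasure_eq_measure)
    show "2 * a * N \<omega> - a\<^sup>2 * (N \<omega>)\<^sup>2 \<le> indicator (\<Union>i<n. E i) \<omega>" for \<omega>
    proof (cases "\<omega> \<in> (\<Union>i<n. E i)")
      case True
      have "0 \<le> (1 - a * N \<omega>)\<^sup>2" by simp
      then show ?thesis using True by (simp add: power2_eq_square algebra_simps)
    next
      case False
      then have "N \<omega> = 0" by (auto simp: N_def intro!: sum.neutral)
      then show ?thesis using False by simp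
    qed
  qed
  also have "\<dots> = prob (\<Union>i<n. E i)" by simp
  finally show ?thesis .
qed

context unit_gaussian_process
begin

text \<open>The second moment method for the number of grid points \<open>i / u\<close> in \<open>[0, R]\<close> at which the process
exceeds \<open>u\<close>. Its mean is of order \<open>R exp (-u\<^sup>2 / 2)\<close>, because the number of grid points, of order
\<open>R u\<close>, compensates the factor \<open>1 / u\<close> in the tail of a single value. Near and intermediate pairs
contribute at most a constant times the mean, far pairs at most \<open>1 + \<epsilon>\<close> times its square.\<close>

lemma prob_exceeds_ge:
  obtains C where "0 < C"
    "\<And>\<epsilon>. 0 < \<epsilon> \<Longrightarrow> \<forall>\<^sub>F u in at_top. \<forall>R>0.
      R * exp (- u\<^sup>2 / 2) / (C + (1 + \<epsilon>) * (R * exp (- u\<^sup>2 / 2))) \<le> prob (exceeds M X u R)"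
proof -
  obtain A q where Aq: "0 < A" "0 < q" "q < 1"
    "\<And>\<epsilon>. 0 < \<epsilon> \<Longrightarrow> \<forall>\<^sub>F u in at_top. \<forall>i j :: nat.
      prob {\<omega> \<in> space M. X (real i / u) \<omega> > u \<and> X (real j / u) \<omega> > u} \<le>
        A * gauss_tail u * q ^ (max i j - min i j)
        + (if real (max i j - min i j) < u * exp (u\<^sup>2 / 8) then gauss_tail u * exp (- 9 * u\<^sup>2 / 32) else 0)
        + (1 + \<epsilon>) * (gauss_tail u)\<^sup>2"
    by (rule prob_pair_grid) blast
  define B where "B = 2 * (A / (1 - q) + 1)"
  have B: "0 < B" using Aq(1-3) by (auto simp: B_def intro!: add_pos_pos)
  define c where "c = exp (-(3/2)) / sqrt (2 * pi)"
  have c: "0 < c" by (simp add: c_def)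
  have main: "\<forall>\<^sub>F u in at_top. \<forall>R>0.
      R * exp (- u\<^sup>2 / 2) / (B / c + (1 + \<epsilon>) * (R * exp (- u\<^sup>2 / 2))) \<le> prob (exceeds M X u R)"
    if \<epsilon>: "0 < \<epsilon>" for \<epsilon>
  proof -
    have "((\<lambda>u::real. (u * exp (u\<^sup>2 / 8) + 1) * exp (- 9 * u\<^sup>2 / 32)) \<longlongrightarrow> 0) at_top"
      by real_asymp
    then have "\<forall>\<^sub>F u::real in at_top. (u * exp (u\<^sup>2 / 8) + 1) * exp (- 9 * u\<^sup>2 / 32) < 1"
      by (rule order_tendstoD) simp
    with Aq(4)[OF \<epsilon>] show ?thesis
      using eventually_ge_at_top[of 1]
    proof eventually_elim
      case (elim u)
      define p where "p = gauss_tail u"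
      have p: "0 < p" using elim(3) by (auto simp: p_def intro: gauss_tail_pos)
      show ?case
      proof (intro allI impI)
        fix R :: real assume R: "0 < R"
        define y where "y = R * exp (- u\<^sup>2 / 2)"
        have y: "0 < y" using R by (simp add: y_def)
        define n where "n = nat \<lfloor>R * u\<rfloor> + 1"
        have n: "R * u \<le> real n" "real n - 1 \<le> R * u"
          using R elim(3) unfolding n_def by (simp_all add: nat_add_distrib) linarith+
        define E where "E i = {\<omega> \<in> space M. X (real i / u) \<omega> > u}" for i :: nat
        have [measurable]: "E i \<in> events" for i unfolding E_def by measurable
        define m where "m = real n * p"
        have m_sum: "m = (\<Sum>i<n. prob (E i))" by (simp add: m_def E_def prob_gt p_def)
        \<comment> \<open>The bound for the pairs at distance \<open>k\<close>, without the part that represents independence.\<close>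
        define g where "g k = A * p * q ^ k + (if real k < u * exp (u\<^sup>2 / 8) then p * exp (- 9 * u\<^sup>2 / 32) else 0)" for k :: nat
        have g_nonneg: "0 \<le> g k" for k using Aq(1-3) p by (auto simp: g_def)
        have "(\<Sum>k<n. g k) \<le> A * p * (1 / (1 - q)) + (u * exp (u\<^sup>2 / 8) + 1) * (p * exp (- 9 * u\<^sup>2 / 32))"
          unfolding g_def sum.distrib sum_distrib_left[symmetric] using Aq(1-3) p elim(3)
          by (intro add_mono mult_left_mono sum_geometric_le sum_if_less_le) auto
        also have "(u * exp (u\<^sup>2 / 8) + 1) * (p * exp (- 9 * u\<^sup>2 / 32)) \<le> 1 * p"
          using elim(2) p mult_right_mono[of "(u * exp (u\<^sup>2 / 8) + 1) * exp (- 9 * u\<^sup>2 / 32)" 1 p]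
          by (simp add: mult_ac)
        finally have "(\<Sum>k<n. g k) \<le> A * p * (1 / (1 - q)) + 1 * p" by simp
        then have "2 * (\<Sum>k<n. g k) \<le> 2 * (A * p * (1 / (1 - q)) + 1 * p)"
          by (rule mult_left_mono) simp
        also have "\<dots> = B * p" by (simp add: B_def distrib_right)
        finally have g_sum: "2 * (\<Sum>k<n. g k) \<le> B * p" .
        have row: "(\<Sum>j<n. prob (E i \<inter> E j)) \<le> B * p + real n * ((1 + \<epsilon>) * p\<^sup>2)" if "i < n" for i
        proof -
          have "prob (E i \<inter> E j) \<le> g (max i j - min i j) + (1 + \<epsilon>) * p\<^sup>2" for j
          proof -
            have "E i \<inter> E j = {\<omega> \<in> space M. X (real i / u) \<omega> > u \<and> X (real j / u) \<omega> > u}"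
              by (auto simp: E_def)
            then show ?thesis unfolding g_def p_def using elim(1) by (simp only:)
          qed
          then have "(\<Sum>j<n. prob (E i \<inter> E j)) \<le> (\<Sum>j<n. g (max i j - min i j) + (1 + \<epsilon>) * p\<^sup>2)"
            by (rule sum_mono)
          also have "\<dots> \<le> 2 * (\<Sum>k<n. g k) + real n * ((1 + \<epsilon>) * p\<^sup>2)"
            using sum_nat_dist_le[of g i n, OF g_nonneg that] by (simp add: sum.distrib)
          finally show ?thesis using g_sum by simp
        qed
        define S where "S = B * m + (1 + \<epsilon>) * m\<^sup>2"
        have "(\<Sum>i<n. \<Sum>j<n. prob (E i \<inter> E j)) \<le> (\<Sum>i<n. B * p + real n * ((1 + \<epsilon>) * p\<^sup>2))"
          by (intro sum_mono row) auto
        also have "\<dots> = S" by (simp add: S_def m_def power2_eq_square algebra_simps)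
        finally have S_ge: "(\<Sum>i<n. \<Sum>j<n. prob (E i \<inter> E j)) \<le> S" .
        have m: "0 < m" using p by (simp add: m_def n_def)
        have S: "0 < S" using m B \<epsilon> by (auto simp: S_def intro!: add_pos_pos)
        have "c * y \<le> R * u * p"
        proof -
          have "std_normal_density u \<le> exp (3/2) * (u * p)"
            unfolding p_def using elim(3) by (rule std_normal_density_le_gauss_tail)
          then have "R * exp (-(3/2)) * std_normal_density u \<le> R * exp (-(3/2)) * (exp (3/2) * (u * p))"
            using R by (intro mult_left_mono) auto
          also have "\<dots> = R * u * p" by (simp add: exp_minus)
          finally show ?thesis by (simp add: c_def y_def std_normal_density_def mult.left_commute)
        qed
        also have "\<dots> \<le> m" unfolding m_def using n p by (intro mult_right_mono) auto
        finally have cy: "c * y \<le> m" .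
        have "y / (B / c + (1 + \<epsilon>) * y) = c * y / (B + (1 + \<epsilon>) * (c * y))"
        proof -
          have "B + (1 + \<epsilon>) * (c * y) = c * (B / c + (1 + \<epsilon>) * y)"
            using c by (simp add: distrib_left)
          then show ?thesis using c by simp
        qed
        also have "\<dots> \<le> m / (B + (1 + \<epsilon>) * m)"
        proof -
          have "c * y * B \<le> m * B" using cy B by (intro mult_right_mono) auto
          then have "c * y * (B + (1 + \<epsilon>) * m) \<le> m * (B + (1 + \<epsilon>) * (c * y))"
            by (simp add: algebra_simps)
          moreover have "0 < B + (1 + \<epsilon>) * (c * y)" "0 < B + (1 + \<epsilon>) * m"
            using B \<epsilon> c y m by (auto intro!: add_pos_pos)
          ultimately show ?thesis by (simp only: frac_le_eq pos_divide_le_eq pos_le_divide_eq times_divide_eq_left)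
        qed
        also have "\<dots> = m\<^sup>2 / S"
        proof -
          have "S = m * (B + (1 + \<epsilon>) * m)" by (simp add: S_def power2_eq_square algebra_simps)
          then show ?thesis using m by (simp add: power2_eq_square)
        qed
        also have "\<dots> \<le> prob (\<Union>i<n. E i)"
          using S S_ge m_sum by (intro prob_Union_second_moment) auto
        also have "\<dots> \<le> prob (exceeds M X u R)"
        proof (rule finite_measure_mono_AE)
          show "exceeds M X u R \<in> events" by (intro sets_exceeds measurable_X)
          show "AE \<omega> in M. \<omega> \<in> (\<Union>i<n. E i) \<longrightarrow> \<omega> \<in> exceeds M X u R"
            using continuous_paths
          proof eventually_elim
            case (elim \<omega>)
            show ?case
            proof
              assume "\<omega> \<in> (\<Union>i<n. E i)"
              then obtain i where i: "i < n" "\<omega> \<in> space M" "X (real i / u) \<omega> > u" by (auto simp: E_def)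
              have "real i \<le> real n - 1" using i(1) by linarith
              with n(2) have "real i \<le> R * u" by linarith
              then have "real i / u \<in> {0..R}" using \<open>1 \<le> u\<close> by (simp add: divide_le_eq)
              from continuous_exceeds_Rats[OF elim R this i(3)] i(2)
              show "\<omega> \<in> exceeds M X u R" by (auto simp: exceeds_def)
            qed
          qed
        qed
        finally show "R * exp (- u\<^sup>2 / 2) / (B / c + (1 + \<epsilon>) * (R * exp (- u\<^sup>2 / 2))) \<le> prob (exceeds M X u R)"
          by (simp only: y_def)
      qed
    qed
  qed
  have "0 < B / c" using B c by simp
  from that[OF this main] show thesis .
qed

end

section \<open>Upper bound for exceedance probabilities\<close>

lemma exp_minus_le_inverse_square:
  fixes y :: real
  assumes "0 < y"
  shows "exp (- y) \<le> 2 / y\<^sup>2"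
proof -
  have "y\<^sup>2 / 2 \<le> exp y" using exp_lower_Taylor_quadratic[of y] assms by simp
  then show ?thesis using assms by (simp add: exp_minus field_simps)
qed

lemma (in prob_space) prob_UN_le:
  assumes "\<And>i. i < n \<Longrightarrow> E i \<in> events" "\<And>i. i < n \<Longrightarrow> prob (E i) \<le> b"
  shows "prob (\<Union>i<n. E i) \<le> real n * b"
proof -
  have "prob (\<Union>i<n. E i) \<le> (\<Sum>i<n. prob (E i))"
    using assms(1) by (intro finite_measure_subadditive_finite) auto
  also have "\<dots> \<le> (\<Sum>i<n. b)" using assms(2) by (intro sum_mono) auto
  finally show ?thesis by simp
qed

lemma dyadic_floor_tendsto:
  fixes x :: real
  shows "(\<lambda>k. of_int \<lfloor>x * 2 ^ k\<rfloor> / 2 ^ k) \<longlonglongrightarrow> x"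
proof -
  have "(\<lambda>k. (1/2::real) ^ k) \<longlonglongrightarrow> 0" by (rule LIMSEQ_realpow_zero) auto
  then have "(\<lambda>k. x - (1/2) ^ k) \<longlonglongrightarrow> x - 0" by (rule tendsto_diff[OF tendsto_const])
  then have lo: "(\<lambda>k. x - (1/2) ^ k) \<longlonglongrightarrow> x" by simp
  have b: "x * 2 ^ k - 1 \<le> of_int \<lfloor>x * 2 ^ k\<rfloor>" "of_int \<lfloor>x * 2 ^ k\<rfloor> \<le> x * 2 ^ k" for k
    by linarith+
  show ?thesis
  proof (rule tendsto_sandwich[OF _ _ lo tendsto_const])
    have "x - (1/2) ^ k \<le> of_int \<lfloor>x * 2 ^ k\<rfloor> / 2 ^ k" for k
    proof -
      have "x - (1/2) ^ k = (x * 2 ^ k - 1) / 2 ^ k" by (simp add: power_divide diff_divide_distrib)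
      also have "\<dots> \<le> of_int \<lfloor>x * 2 ^ k\<rfloor> / 2 ^ k" using b(1) by (rule divide_right_mono) simp
      finally show ?thesis .
    qed
    then show "\<forall>\<^sub>F k in sequentially. x - (1/2) ^ k \<le> of_int \<lfloor>x * 2 ^ k\<rfloor> / 2 ^ k" by simp
    have "of_int \<lfloor>x * 2 ^ k\<rfloor> / 2 ^ k \<le> x" for k
      using divide_right_mono[OF b(2), of "2 ^ k" k] by simp
    then show "\<forall>\<^sub>F k in sequentially. of_int \<lfloor>x * 2 ^ k\<rfloor> / 2 ^ k \<le> x" by simp
  qed
qed

context unit_gaussian_process
begin

text \<open>For a positive correlation, \<open>X t > v\<close> pulls \<open>X s\<close> up to at least \<open>r v\<close>; falling to \<open>v - d\<close> is a
deviation of the independent residual.\<close>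

lemma prob_drop:
  assumes q: "0 < r (s - t)" "r (s - t) < 1"
  shows "prob {\<omega> \<in> space M. X t \<omega> > v \<and> X s \<omega> \<le> v - d}
    \<le> gauss_tail v * gauss_tail ((d - (1 - r (s - t)) * v) / sqrt (1 - (r (s - t))\<^sup>2))"
proof -
  define c where "c = sqrt (1 - (r (s - t))\<^sup>2)"
  have "(r (s - t))\<^sup>2 < 1" using q by (simp add: abs_square_less_1)
  then have c: "0 < c" by (simp add: c_def)
  have "prob {\<omega> \<in> space M. X t \<omega> > v \<and> X s \<omega> \<le> v - d}
    \<le> prob {\<omega> \<in> space M. X t \<omega> > v \<and> (-1) * (X s \<omega> - r (s - t) * X t \<omega>) / c > (d - (1 - r (s - t)) * v) / c}"
  proof (rule finite_measure_mono)
    show "{\<omega> \<in> space M. X t \<omega> > v \<and> X s \<omega> \<le> v - d} \<subseteq>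
      {\<omega> \<in> space M. X t \<omega> > v \<and> (-1) * (X s \<omega> - r (s - t) * X t \<omega>) / c > (d - (1 - r (s - t)) * v) / c}"
    proof clarify
      fix \<omega> assume \<omega>: "v < X t \<omega>" "X s \<omega> \<le> v - d"
      have "r (s - t) * v < r (s - t) * X t \<omega>" using \<omega>(1) q(1) by (rule mult_strict_left_mono)
      then have "d - (1 - r (s - t)) * v < (-1) * (X s \<omega> - r (s - t) * X t \<omega>)"
        using \<omega>(2) by (simp add: algebra_simps)
      then show "(d - (1 - r (s - t)) * v) / c < (-1) * (X s \<omega> - r (s - t) * X t \<omega>) / c"
        using c by (rule divide_strict_right_mono)
    qed
  qed measurable
  also have "\<dots> = gauss_tail v * gauss_tail ((d - (1 - r (s - t)) * v) / c)"
    unfolding c_def by (rule prob_pair_indep) (use q in auto)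
  finally show ?thesis by (simp only: c_def)
qed

text \<open>Chaining over the dyadic points of an interval of length \<open>1 / u\<close>. At generation \<open>k\<close> the level is
\<open>v k = u - B / u (3/4)^k\<close>, which increases to \<open>u\<close>. If \<open>v (k + 1)\<close> is exceeded at generation \<open>k + 1\<close>
but \<open>v k\<close> is not exceeded before, then the process drops by \<open>v (k + 1) - v k\<close> between neighbouring
points (the event \<open>F k j\<close>). This drop shrinks like \<open>(3/4)^k\<close>, but the typical increment shrinks like
\<open>(1/2)^k\<close>, so the probability of \<open>F k j\<close> is at most the tail at \<open>v 0\<close> times a factor summable
even against the \<open>2^k\<close> points of generation \<open>k\<close>.\<close>

lemma prob_short_interval:
  obtains D u0 where "0 < D" "1 \<le> u0"
    "\<And>u a. u0 \<le> u \<Longrightarrow>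
      prob (\<Union>k. {\<omega> \<in> space M. \<exists>j<2 ^ k. X (a + real j / 2 ^ k / u) \<omega> > u}) \<le> D * exp (- u\<^sup>2 / 2) / u"
proof -
  obtain t0 C where t0: "0 < t0" "0 < C" "\<And>t. \<bar>t\<bar> \<le> t0 \<Longrightarrow> 1 - r t \<le> C * t\<^sup>2"
    by (rule ex_quadratic_bound) blast
  obtain s0 c where s0: "0 < s0" "0 < c" "\<And>t. s0 \<le> \<bar>t\<bar> \<Longrightarrow> \<bar>r t\<bar> \<le> 1 / 12"
    "\<And>t. \<bar>t\<bar> < s0 \<Longrightarrow> c * t\<^sup>2 \<le> 1 - r t"
    by (rule ex_nondegeneracy) blast
  define K where "K = sqrt (2 * C)"
  have K: "0 < K" "K\<^sup>2 = 2 * C" using t0(2) by (auto simp: K_def)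
  \<comment> \<open>The part \<open>2 C\<close> absorbs the loss \<open>(1 - r) v\<close> of the mean, the part \<open>4 K\<close> gives at least \<open>(3/2)^k\<close>
     standard deviations of the residual for the remaining drop.\<close>
  define B where "B = 2 * C + 4 * K"
  have B: "0 < B" "2 * C \<le> B" "4 * K \<le> B" using t0(2) K by (auto simp: B_def)
  define u0 where "u0 = Max {1, 1 / t0, 2 / s0, 2 * C, B}"
  have u0: "1 \<le> u0" "1 / t0 \<le> u0" "2 / s0 \<le> u0" "2 * C \<le> u0" "B \<le> u0" unfolding u0_def by simp_all
  define D where "D = 15 * (1 + exp (3/2) * B * exp B)"
  have D: "0 < D" using B by (simp add: D_def add_pos_nonneg)
  have "prob (\<Union>k. {\<omega> \<in> space M. \<exists>j<2 ^ k. X (a + real j / 2 ^ k / u) \<omega> > u}) \<le> D * exp (- u\<^sup>2 / 2) / u"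
    if u: "u0 \<le> u" for u a
  proof -
    have u1: "1 \<le> u" "B \<le> u" "2 * C \<le> u" using u u0 by linarith+
    have u_sq: "u \<le> u\<^sup>2" using u1 by (simp add: power2_eq_square)
    have ut: "1 / u \<le> t0" using order_trans[OF u0(2) u] t0(1) u1 by (simp add: field_simps)
    have us: "1 / u < s0"
    proof -
      have "2 / s0 \<le> u" using u0(3) u by linarith
      then show ?thesis using s0(1) u1 by (simp add: field_simps)
    qed
    define v where "v k = u - B / u * (3/4) ^ k" for k :: nat
    have v_mono: "v k \<le> v (Suc k)" for k
      unfolding v_def using B u1 by (intro diff_left_mono mult_left_mono power_decreasing) auto
    have v0: "v 0 = u - B / u" by (simp add: v_def)
    have "B \<le> u * u" using u1(2) u_sq unfolding power2_eq_square by (rule order_trans)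
    then have v0_nonneg: "0 \<le> v 0" using u1 by (simp add: v0 divide_le_eq)
    have v_ge: "v 0 \<le> v k" for k
      by (induction k) (auto intro: order_trans[OF _ v_mono])
    have v_le: "v k \<le> u" for k using B u1 by (simp add: v_def)
    define pt where "pt k j = a + real j / 2 ^ k / u" for k j :: nat
    define E where "E k = {\<omega> \<in> space M. \<exists>j<2 ^ k. X (pt k j) \<omega> > v k}" for k
    define F where "F k j = {\<omega> \<in> space M. X (pt (Suc k) (2 * j + 1)) \<omega> > v (Suc k) \<and>
      X (pt k j) \<omega> \<le> v (Suc k) - (v (Suc k) - v k)}" for k j
    have [measurable]: "E k \<in> events" "F k j \<in> events" for k j unfolding E_def F_def by measurable
    have F_le: "prob (F k j) \<le> gauss_tail (v 0) * (8 * (16 / 81) ^ k)" for k j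
    proof -
      define \<tau> where "\<tau> = 1 / 2 ^ Suc k / u"
      have diff: "pt k j - pt (Suc k) (2 * j + 1) = - \<tau>"
        by (simp add: pt_def \<tau>_def add_divide_distrib)
      have two: "1 \<le> (2::real) ^ k" by simp
      have \<tau>: "0 < \<tau>" "\<tau> \<le> 1 / u"
      proof -
        show "0 < \<tau>" using u1 by (simp add: \<tau>_def)
        have "1 / 2 ^ Suc k / u \<le> 1 / u" using u1 by (intro divide_right_mono) (auto simp: divide_le_eq intro: order_trans[OF two])
        then show "\<tau> \<le> 1 / u" by (simp add: \<tau>_def)
      qed
      define q where "q = r (- \<tau>)"
      have q1: "1 - q \<le> C * \<tau>\<^sup>2" using t0(3)[of "- \<tau>"] \<tau> ut by (simp add: q_def)
      have "c * \<tau>\<^sup>2 \<le> 1 - q" using s0(4)[of "- \<tau>"] \<tau> us by (simp add: q_def)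
      moreover have "0 < c * \<tau>\<^sup>2" using s0(2) \<tau>(1) by simp
      ultimately have q2: "q < 1" by linarith
      have "\<tau> * \<tau> \<le> (1 / u) * 1"
        using \<tau> u1 by (intro mult_mono) (auto intro: order_trans)
      then have "C * \<tau>\<^sup>2 \<le> C * (1 / u)"
        unfolding power2_eq_square using t0(2) by (intro mult_left_mono) auto
      also have "\<dots> \<le> 1 / 2" using u1 by (simp add: field_simps)
      finally have q3: "0 < q" using q1 by linarith
      define d where "d = v (Suc k) - v k"
      have d: "d = B / (4 * u) * (3/4) ^ k" by (simp add: d_def v_def field_simps)
      have small: "(1 - q) * v (Suc k) \<le> d / 2"
      proof -
        have "(1 - q) * v (Suc k) \<le> C * \<tau>\<^sup>2 * u"
          using q1 q2 v_le[of "Suc k"] v_ge[of "Suc k"] v0_nonneg t0(2) by (intro mult_mono) auto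
        also have "C * \<tau>\<^sup>2 * u = C / (4 * u) * (1/4) ^ k"
          using u1 by (simp add: \<tau>_def power2_eq_square power_divide field_simps power_mult_distrib[symmetric])
        also have "\<dots> \<le> (B / 2) / (4 * u) * (3/4) ^ k"
          using B u1 t0(2) by (intro mult_mono divide_right_mono power_mono) auto
        also have "\<dots> = d / 2" by (simp add: d)
        finally show ?thesis .
      qed
      define cc where "cc = sqrt (1 - q\<^sup>2)"
      have "q\<^sup>2 < 1" using q2 q3 by (simp add: abs_square_less_1)
      then have cc: "0 < cc" by (simp add: cc_def)
      have "1 - q\<^sup>2 = (1 - q) * (1 + q)" by (simp add: power2_eq_square algebra_simps)
      also have "\<dots> \<le> (C * \<tau>\<^sup>2) * 2" using q1 q2 q3 by (intro mult_mono) auto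
      also have "\<dots> = (K * \<tau>)\<^sup>2" using K by (simp add: power_mult_distrib)
      finally have "cc \<le> K * \<tau>" unfolding cc_def using K(1) \<tau>(1) by (intro real_le_lsqrt) auto
      have "(3/2) ^ k * cc \<le> (3/2) ^ k * (K * \<tau>)" using \<open>cc \<le> K * \<tau>\<close> by (intro mult_left_mono) auto
      also have "\<dots> = 4 * K / (8 * u) * (3/4) ^ k"
        by (simp add: \<tau>_def power_divide power_mult_distrib[symmetric] field_simps)
      also have "\<dots> \<le> B / (8 * u) * (3/4) ^ k"
        using B u1 by (intro mult_right_mono divide_right_mono) auto
      also have "\<dots> \<le> d - (1 - q) * v (Suc k)" using small by (simp add: d)
      finally have x: "(3/2) ^ k \<le> (d - (1 - q) * v (Suc k)) / cc"
        using cc by (simp add: pos_le_divide_eq)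
      have "prob (F k j) \<le> gauss_tail (v (Suc k)) * gauss_tail ((d - (1 - q) * v (Suc k)) / cc)"
        using prob_drop[of "pt k j" "pt (Suc k) (2 * j + 1)" "v (Suc k)" d] q2 q3
        unfolding diff F_def d_def cc_def q_def by simp
      also have "\<dots> \<le> gauss_tail (v 0) * (8 * (16 / 81) ^ k)"
      proof (intro mult_mono gauss_tail_nonneg)
        show "gauss_tail (v (Suc k)) \<le> gauss_tail (v 0)" by (intro gauss_tail_antimono v_ge)
        have "gauss_tail ((d - (1 - q) * v (Suc k)) / cc) \<le> gauss_tail ((3/2) ^ k)"
          using x by (rule gauss_tail_antimono)
        also have "\<dots> \<le> exp (- ((3/2) ^ k)\<^sup>2 / 2)" by (intro gauss_tail_le_exp one_le_power) simp
        also have "\<dots> = exp (- ((9/4) ^ k / 2))"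
          by (simp add: power2_eq_square power_mult_distrib[symmetric])
        also have "\<dots> \<le> 2 / ((9/4) ^ k / 2)\<^sup>2" by (rule exp_minus_le_inverse_square) simp
        also have "\<dots> = 8 * (16 / 81) ^ k"
          by (simp add: power2_eq_square power_divide power_mult_distrib[symmetric] field_simps)
        finally show "gauss_tail ((d - (1 - q) * v (Suc k)) / cc) \<le> 8 * (16 / 81) ^ k" .
      qed
      finally show ?thesis .
    qed
    have E_Suc: "E (Suc k) \<subseteq> E k \<union> (\<Union>j<2 ^ k. F k j)" for k
    proof
      fix \<omega> assume "\<omega> \<in> E (Suc k)"
      then obtain i where i: "\<omega> \<in> space M" "i < 2 ^ Suc k" "X (pt (Suc k) i) \<omega> > v (Suc k)"
        by (auto simp: E_def)
      define j where "j = i div 2"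
      have j: "j < 2 ^ k" using i(2) by (simp add: j_def less_mult_imp_div_less mult.commute)
      show "\<omega> \<in> E k \<union> (\<Union>j<2 ^ k. F k j)"
      proof (cases "X (pt k j) \<omega> > v k")
        case True
        then show ?thesis using i(1) j by (auto simp: E_def)
      next
        case False
        have "i \<noteq> 2 * j"
        proof
          assume "i = 2 * j"
          then have "pt (Suc k) i = pt k j" by (simp add: pt_def)
          with i(3) False v_mono[of k] show False by simp
        qed
        then have "i = 2 * j + 1" unfolding j_def by presburger
        then have "\<omega> \<in> F k j" using i False by (simp add: F_def)
        with j show ?thesis by blast
      qed
    qed
    have E_le: "prob (E k) \<le> gauss_tail (v 0) * (1 + 8 * (\<Sum>i<k. (32 / 81) ^ i))" for k
    proof (induction k)
      case 0
      show ?case by (simp add: E_def prob_gt)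
    next
      case (Suc k)
      have "prob (E (Suc k)) \<le> prob (E k \<union> (\<Union>j<2 ^ k. F k j))"
        by (rule finite_measure_mono[OF E_Suc]) measurable
      also have "\<dots> \<le> prob (E k) + prob (\<Union>j<2 ^ k. F k j)"
        by (rule measure_Un_le) measurable
      also have "prob (\<Union>j<2 ^ k. F k j) \<le> real (2 ^ k) * (gauss_tail (v 0) * (8 * (16 / 81) ^ k))"
        by (rule prob_UN_le) (measurable, rule F_le)
      also have "\<dots> = gauss_tail (v 0) * (8 * (32 / 81) ^ k)"
        by (simp add: power_mult_distrib[symmetric])
      finally show ?case using Suc.IH by (simp add: distrib_left)
    qed
    \<comment> \<open>\<open>1 + 8 / (1 - 32 / 81) = 697 / 49 < 15\<close>\<close>
    have E_le': "prob (E k) \<le> 15 * gauss_tail (v 0)" for k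
    proof -
      have "(\<Sum>i<k. (32 / 81 :: real) ^ i) \<le> 1 / (1 - 32 / 81)" by (rule sum_geometric_le) auto
      then have "1 + 8 * (\<Sum>i<k. (32 / 81) ^ i) \<le> (15::real)" by simp
      then have "gauss_tail (v 0) * (1 + 8 * (\<Sum>i<k. (32 / 81) ^ i)) \<le> gauss_tail (v 0) * 15"
        by (intro mult_left_mono gauss_tail_nonneg)
      with E_le[of k] show ?thesis by simp
    qed
    define H where "H k = {\<omega> \<in> space M. \<exists>j<2 ^ k. X (pt k j) \<omega> > u}" for k
    have [measurable]: "H k \<in> events" for k unfolding H_def by measurable
    have H_E: "H k \<subseteq> E k" for k using v_le[of k] by (auto simp: H_def E_def intro: le_less_trans)
    have "incseq H"
    proof (rule incseq_SucI)
      fix k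
      show "H k \<subseteq> H (Suc k)"
      proof
        fix \<omega> assume "\<omega> \<in> H k"
        then obtain j where "\<omega> \<in> space M" "j < 2 ^ k" "X (pt k j) \<omega> > u" by (auto simp: H_def)
        moreover have "pt (Suc k) (2 * j) = pt k j" by (simp add: pt_def)
        ultimately show "\<omega> \<in> H (Suc k)" by (auto simp: H_def intro!: exI[of _ "2 * j"])
      qed
    qed
    then have "(\<lambda>k. prob (H k)) \<longlonglongrightarrow> prob (\<Union>k. H k)"
      by (intro finite_Lim_measure_incseq) auto
    moreover have "prob (H k) \<le> 15 * gauss_tail (v 0)" for k
      using finite_measure_mono[OF H_E] E_le'[of k] by (meson \<open>\<And>k. E k \<in> events\<close> order_trans)
    ultimately have "prob (\<Union>k. H k) \<le> 15 * gauss_tail (v 0)"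
      by (intro LIMSEQ_le_const2) auto
    also have "gauss_tail (v 0) \<le> gauss_tail u * (1 + exp (3/2) * (u * (B / u)) * exp (u * (B / u)))"
      unfolding v0 using u1 B u_sq v0_nonneg by (intro gauss_tail_shift) (auto simp: v0)
    also have "u * (B / u) = B" using u1 by simp
    also have "gauss_tail u \<le> std_normal_density u / u" using u1 by (intro gauss_tail_le) auto
    also have "std_normal_density u \<le> exp (- u\<^sup>2 / 2)" by (rule std_normal_density_le)
    finally have "prob (\<Union>k. H k) \<le> 15 * (exp (- u\<^sup>2 / 2) / u * (1 + exp (3/2) * B * exp B))"
      using u1 B by (simp add: divide_right_mono mult_right_mono)
    also have "\<dots> = D * exp (- u\<^sup>2 / 2) / u" by (simp add: D_def)
    finally show ?thesis by (simp only: H_def pt_def)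
  qed
  then show thesis using D u0(1) by (intro that[of D u0]) auto
qed

text \<open>About \<open>R u\<close> intervals of length \<open>1 / u\<close> cover \<open>[0, R]\<close>, and on each of them continuity reduces an
exceedance to one at a dyadic point.\<close>

lemma prob_exceeds_le:
  obtains D u0 where "0 < D"
    "\<And>u R. u0 \<le> u \<Longrightarrow> 0 \<le> R \<Longrightarrow> prob (exceeds M X u R) \<le> D * ((R + 1) * exp (- u\<^sup>2 / 2))"
proof -
  obtain D u0 where D: "0 < D" "1 \<le> u0" and short: "\<And>u a. u0 \<le> u \<Longrightarrow>
      prob (\<Union>k. {\<omega> \<in> space M. \<exists>j<2 ^ k. X (a + real j / 2 ^ k / u) \<omega> > u}) \<le> D * exp (- u\<^sup>2 / 2) / u"
    by (rule prob_short_interval) blast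
  have "prob (exceeds M X u R) \<le> D * ((R + 1) * exp (- u\<^sup>2 / 2))" if u: "u0 \<le> u" and R: "0 \<le> R" for u R
  proof -
    have u1: "1 \<le> u" using u D by simp
    define n where "n = nat \<lfloor>R * u\<rfloor> + 1"
    have n: "real n \<le> R * u + 1" using R u1 by (simp add: n_def)
    define H where "H i = (\<Union>k. {\<omega> \<in> space M. \<exists>j<2 ^ k. X (real i / u + real j / 2 ^ k / u) \<omega> > u})" for i :: nat
    have [measurable]: "H i \<in> events" for i unfolding H_def by measurable
    have "prob (exceeds M X u R) \<le> prob (\<Union>i<n. H i)"
    proof (rule finite_measure_mono_AE)
      show "(\<Union>i<n. H i) \<in> events" by measurable
      show "AE \<omega> in M. \<omega> \<in> exceeds M X u R \<longrightarrow> \<omega> \<in> (\<Union>i<n. H i)"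
        using continuous_paths
      proof eventually_elim
        case (elim \<omega>)
        show ?case
        proof
          assume "\<omega> \<in> exceeds M X u R"
          then obtain t where t: "\<omega> \<in> space M" "0 \<le> t" "t \<le> R" "X t \<omega> > u" by (auto simp: exceeds_def)
          define i where "i = nat \<lfloor>t * u\<rfloor>"
          define x where "x = t * u - real i"
          have x: "0 \<le> x" "x < 1" using t(2) u1 by (auto simp: x_def i_def) linarith
          have "t * u \<le> R * u" using t(3) u1 by simp
          then have i: "i < n" by (simp add: i_def n_def less_Suc_eq_le nat_mono floor_mono)
          define j where "j k = nat \<lfloor>x * 2 ^ k\<rfloor>" for k
          have j_real: "real (j k) = of_int \<lfloor>x * 2 ^ k\<rfloor>" for k using x by (simp add: j_def)
          have j: "j k < 2 ^ k" for k
          proof -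
            have "x * 2 ^ k < 1 * 2 ^ k" using x(2) by (intro mult_strict_right_mono) auto
            then have "real (j k) < 2 ^ k" unfolding j_real by linarith
            then show ?thesis using of_nat_less_iff[of "j k" "2 ^ k", where 'a = real] by simp
          qed
          have "(\<lambda>k. real (j k) / 2 ^ k) \<longlonglongrightarrow> x"
            unfolding j_real by (rule dyadic_floor_tendsto)
          then have "(\<lambda>k. real i / u + real (j k) / 2 ^ k / u) \<longlonglongrightarrow> real i / u + x / u"
            using u1 by (intro tendsto_add tendsto_const tendsto_divide) auto
          also have "real i / u + x / u = t" using u1 by (simp add: x_def diff_divide_distrib)
          finally have "(\<lambda>k. X (real i / u + real (j k) / 2 ^ k / u) \<omega>) \<longlonglongrightarrow> X t \<omega>"
            by (rule continuous_on_tendsto_compose[OF elim]) auto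
          then have "\<forall>\<^sub>F k in sequentially. X (real i / u + real (j k) / 2 ^ k / u) \<omega> > u"
            using t(4) by (rule order_tendstoD)
          then obtain k where "X (real i / u + real (j k) / 2 ^ k / u) \<omega> > u"
            by (auto simp: eventually_sequentially)
          then have "\<omega> \<in> H i" using t(1) j[of k] by (auto simp: H_def)
          with i show "\<omega> \<in> (\<Union>i<n. H i)" by blast
        qed
      qed
    qed
    also have "\<dots> \<le> real n * (D * exp (- u\<^sup>2 / 2) / u)"
      using short[OF u] by (intro prob_UN_le) (auto simp: H_def)
    also have "\<dots> \<le> (R * u + 1) * (D * exp (- u\<^sup>2 / 2) / u)"
      using n D u1 by (intro mult_right_mono) auto
    also have "\<dots> \<le> ((R + 1) * u) * (D * exp (- u\<^sup>2 / 2) / u)"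
      using R D u1 by (intro mult_right_mono) (auto simp: distrib_right)
    also have "\<dots> = D * ((R + 1) * exp (- u\<^sup>2 / 2))" using u1 by simp
    finally show ?thesis .
  qed
  then show thesis using D(1) by (intro that[of D u0]) auto
qed

end

section \<open>Levels that separate two maxima\<close>

text \<open>Here \<open>P v R\<close> and \<open>Q v R\<close> are the probabilities that two normalised processes exceed \<open>v\<close> on an
interval of length \<open>R\<close>. At the level with \<open>exp (-v\<^sup>2 / 2) = \<epsilon> / R\<close> the upper bound for \<open>P\<close> and the lower
bound for \<open>Q\<close> do not depend on \<open>R\<close>, and \<open>\<epsilon>\<close> is chosen such that the former is \<open>1 / 2\<close>.\<close>

lemma eventually_balanced_level:
  fixes P Q :: "real \<Rightarrow> real \<Rightarrow> real"
  assumes P: "0 < D" "\<And>v R. v0 \<le> v \<Longrightarrow> 0 \<le> R \<Longrightarrow> P v R \<le> D * ((R + 1) * exp (- v\<^sup>2 / 2))"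
    and Q: "0 < C" "\<And>\<epsilon>. 0 < \<epsilon> \<Longrightarrow> \<forall>\<^sub>F v in at_top. \<forall>R>0.
      R * exp (- v\<^sup>2 / 2) / (C + (1 + \<epsilon>) * (R * exp (- v\<^sup>2 / 2))) \<le> Q v R"
    and \<rho>: "0 < \<rho>" "0 < \<rho>'"
  shows "\<exists>c>0. \<forall>\<^sub>F R in at_top. \<exists>v. c \<le> Q v (\<rho>' * R) * (1 - P v (\<rho> * R))"
proof -
  define \<epsilon> where "\<epsilon> = 1 / (2 * D * (\<rho> + 1))"
  have \<epsilon>: "0 < \<epsilon>" using P(1) \<rho> by (simp add: \<epsilon>_def)
  define y where "y = \<rho>' * \<epsilon>"
  define z where "z = y / (C + (1 + 1) * y)"
  define c where "c = z / 2"
  have y: "0 < y" using \<rho> \<epsilon> by (simp add: y_def)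
  have c: "0 < c" using y Q(1) by (simp add: c_def z_def add_pos_pos)
  define v where "v R = sqrt (2 * ln (R / \<epsilon>))" for R
  have v_top: "filterlim v at_top at_top" unfolding v_def using \<epsilon> by real_asymp
  have "\<forall>\<^sub>F R in at_top. v0 \<le> v R"
    using v_top by (auto simp: filterlim_at_top)
  moreover have "\<forall>\<^sub>F R in at_top. \<forall>R'>0.
      R' * exp (- (v R)\<^sup>2 / 2) / (C + (1 + 1) * (R' * exp (- (v R)\<^sup>2 / 2))) \<le> Q (v R) R'"
    using eventually_compose_filterlim[OF Q(2) v_top, of 1] by simp
  moreover have "\<forall>\<^sub>F R in at_top. max 1 \<epsilon> \<le> R" by (rule eventually_ge_at_top)
  ultimately have "\<forall>\<^sub>F R in at_top. c \<le> Q (v R) (\<rho>' * R) * (1 - P (v R) (\<rho> * R))"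
  proof eventually_elim
    case (elim R)
    have R: "1 \<le> R" "\<epsilon> \<le> R" using elim(3) by auto
    have "0 \<le> ln (R / \<epsilon>)" using R \<epsilon> by (intro ln_ge_zero) simp
    then have "exp (- (v R)\<^sup>2 / 2) = exp (- ln (R / \<epsilon>))" by (simp add: v_def)
    also have "\<dots> = \<epsilon> / R" using R \<epsilon> by (simp add: exp_minus)
    finally have e: "exp (- (v R)\<^sup>2 / 2) = \<epsilon> / R" .
    have "P (v R) (\<rho> * R) \<le> D * ((\<rho> * R + 1) * (\<epsilon> / R))"
      using P(2)[OF elim(1), of "\<rho> * R"] \<rho> R unfolding e by simp
    also have "\<dots> \<le> D * ((\<rho> * R + R) * (\<epsilon> / R))"
      using P(1) R \<epsilon> by (intro mult_left_mono mult_right_mono) auto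
    also have "(\<rho> * R + R) * (\<epsilon> / R) = (\<rho> + 1) * \<epsilon>" using R by (simp add: field_simps)
    also have "D * ((\<rho> + 1) * \<epsilon>) = 1 / 2"
    proof -
      have "D * (\<rho> + 1) \<noteq> 0" using P(1) \<rho> by simp
      then show ?thesis by (simp add: \<epsilon>_def)
    qed
    finally have P': "1 / 2 \<le> 1 - P (v R) (\<rho> * R)" by simp
    have "\<rho>' * R * exp (- (v R)\<^sup>2 / 2) = y" unfolding e y_def using R by simp
    then have "z \<le> Q (v R) (\<rho>' * R)"
      using elim(2)[rule_format, of "\<rho>' * R"] \<rho> R by (simp add: z_def)
    then have Q': "2 * c \<le> Q (v R) (\<rho>' * R)" by (simp add: c_def)
    have "2 * c * (1 / 2) \<le> Q (v R) (\<rho>' * R) * (1 - P (v R) (\<rho> * R))"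
      using P' Q' c by (intro mult_mono) auto
    then show ?case by simp
  qed
  then have "\<forall>\<^sub>F R in at_top. \<exists>v. c \<le> Q v (\<rho>' * R) * (1 - P v (\<rho> * R))"
    by (rule eventually_mono) blast
  with c show ?thesis by blast
qed

text \<open>The level is \<open>u = \<kappa> sqrt (2 ln R)\<close> with \<open>\<sigma> < \<kappa> < \<tau>\<close>. Then \<open>R exp (- (u / s)\<^sup>2 / 2)\<close> is the power of \<open>R\<close>
with exponent \<open>1 - (\<kappa> / s)\<^sup>2\<close>, which is negative for \<open>s = \<sigma>\<close> and positive for \<open>s = \<tau>\<close>.\<close>

lemma eventually_separating_level:
  fixes P Q :: "real \<Rightarrow> real \<Rightarrow> real"
  assumes P: "0 < D" "\<And>v R. v0 \<le> v \<Longrightarrow> 0 \<le> R \<Longrightarrow> P v R \<le> D * ((R + 1) * exp (- v\<^sup>2 / 2))"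
    and Q: "0 < C" "\<And>\<epsilon>. 0 < \<epsilon> \<Longrightarrow> \<forall>\<^sub>F v in at_top. \<forall>R>0.
      R * exp (- v\<^sup>2 / 2) / (C + (1 + \<epsilon>) * (R * exp (- v\<^sup>2 / 2))) \<le> Q v R"
    and \<rho>: "0 < \<rho>" "0 < \<rho>'" and \<sigma>: "0 < \<sigma>" "\<sigma> < \<tau>" and \<delta>: "0 < \<delta>" "\<delta> < 1"
  shows "\<forall>\<^sub>F R in at_top. \<exists>u. 1 - \<delta> \<le> Q (u / \<tau>) (\<rho>' * R) * (1 - P (u / \<sigma>) (\<rho> * R))"
proof -
  define \<kappa> where "\<kappa> = (\<sigma> + \<tau>) / 2"
  have \<kappa>: "\<sigma> < \<kappa>" "\<kappa> < \<tau>" "0 < \<kappa>" using \<sigma> by (auto simp: \<kappa>_def)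
  define a where "a = (\<kappa> / \<sigma>)\<^sup>2"
  define b where "b = (\<kappa> / \<tau>)\<^sup>2"
  have a: "1 < a" using \<kappa> \<sigma> unfolding a_def by (intro one_less_power) auto
  have b: "b < 1" using \<kappa> \<sigma> unfolding b_def abs_square_less_1 by (simp add: abs_of_pos)
  define u where "u R = \<kappa> * sqrt (2 * ln R)" for R :: real
  have u_top: "filterlim (\<lambda>R. u R / s) at_top at_top" if "0 < s" for s
    unfolding u_def using that \<kappa>(3) by real_asymp
  have limP: "((\<lambda>R. D * ((\<rho> * R + 1) * exp (- (a * ln R)))) \<longlongrightarrow> 0) at_top"
    using a P(1) \<rho>(1) by real_asymp
  have "filterlim (\<lambda>R. \<rho>' * exp ((1 - b) * ln R)) at_top at_top"
    using b \<rho>(2)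
    by (intro filterlim_tendsto_pos_mult_at_top[OF tendsto_const] filterlim_compose[OF exp_at_top] ln_at_top) auto
  moreover have "\<forall>\<^sub>F R in at_top. \<rho>' * exp ((1 - b) * ln R) = \<rho>' * R * exp (- (b * ln R))"
    using eventually_gt_at_top[of 0]
    by eventually_elim (simp add: left_diff_distrib exp_diff exp_minus divide_inverse)
  ultimately have mean_top: "filterlim (\<lambda>R. \<rho>' * R * exp (- (b * ln R))) at_top at_top"
    by (rule filterlim_mono_eventually[OF _ order_refl order_refl])
  have "((\<lambda>y. y / (C + (1 + \<delta> / 2) * y)) \<longlongrightarrow> inverse (1 + \<delta> / 2)) at_top"
    using Q(1) \<delta>(1) by real_asymp
  from filterlim_compose[OF this mean_top]
  have "((\<lambda>R. \<rho>' * R * exp (- (b * ln R)) / (C + (1 + \<delta> / 2) * (\<rho>' * R * exp (- (b * ln R))))) \<longlongrightarrow> inverse (1 + \<delta> / 2)) at_top" .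
  moreover have "1 - \<delta> / 2 < inverse (1 + \<delta> / 2)"
    using \<delta> by (simp add: field_simps)
  ultimately have evQ: "\<forall>\<^sub>F R in at_top. 1 - \<delta> / 2 <
      \<rho>' * R * exp (- (b * ln R)) / (C + (1 + \<delta> / 2) * (\<rho>' * R * exp (- (b * ln R))))"
    by (rule order_tendstoD)
  have evP: "\<forall>\<^sub>F R in at_top. D * ((\<rho> * R + 1) * exp (- (a * ln R))) < \<delta> / 2"
    using limP by (rule order_tendstoD) (use \<delta> in simp)
  have evv: "\<forall>\<^sub>F R in at_top. v0 \<le> u R / \<sigma>"
    using u_top[OF \<sigma>(1)] by (auto simp: filterlim_at_top)
  have evQ': "\<forall>\<^sub>F R in at_top. \<forall>R'>0. R' * exp (- (u R / \<tau>)\<^sup>2 / 2) /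
      (C + (1 + \<delta> / 2) * (R' * exp (- (u R / \<tau>)\<^sup>2 / 2))) \<le> Q (u R / \<tau>) R'"
    using eventually_compose_filterlim[OF Q(2) u_top[of \<tau>], of "\<delta> / 2"] \<delta> \<sigma> by simp
  have "\<forall>\<^sub>F R in at_top. 1 - \<delta> \<le> Q (u R / \<tau>) (\<rho>' * R) * (1 - P (u R / \<sigma>) (\<rho> * R))"
    using evQ evP evv evQ' eventually_ge_at_top[of 1]
  proof eventually_elim
    case (elim R)
    have "0 \<le> ln R" using elim(5) by simp
    then have exps: "- (u R / s)\<^sup>2 / 2 = - ((\<kappa> / s)\<^sup>2 * ln R)" for s
      by (simp add: u_def power_mult_distrib power_divide)
    have "P (u R / \<sigma>) (\<rho> * R) \<le> D * ((\<rho> * R + 1) * exp (- (a * ln R)))"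
      using P(2)[OF elim(3), of "\<rho> * R"] \<rho> elim(5) unfolding exps a_def by simp
    then have P': "1 - \<delta> / 2 \<le> 1 - P (u R / \<sigma>) (\<rho> * R)" using elim(2) by simp
    have "\<rho>' * R * exp (- (b * ln R)) / (C + (1 + \<delta> / 2) * (\<rho>' * R * exp (- (b * ln R)))) \<le> Q (u R / \<tau>) (\<rho>' * R)"
      using elim(4)[rule_format, of "\<rho>' * R"] \<rho> elim(5) unfolding exps b_def by simp
    then have Q': "1 - \<delta> / 2 \<le> Q (u R / \<tau>) (\<rho>' * R)" using elim(1) by simp
    have "1 - \<delta> \<le> (1 - \<delta> / 2) * (1 - \<delta> / 2)"
      by (simp add: algebra_simps)
    also have "\<dots> \<le> Q (u R / \<tau>) (\<rho>' * R) * (1 - P (u R / \<sigma>) (\<rho> * R))"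
      using P' Q' \<delta> by (intro mult_mono) auto
    finally show ?case .
  qed
  then show ?thesis by (rule eventually_mono) blast
qed

section \<open>Crossings of additive functions\<close>

text \<open>A crossing path visits every abscissa in \<open>[0, a]\<close>, in particular one where \<open>h1\<close> is maximal; its
height there serves for all abscissae at once. Conversely such a height gives a horizontal segment.\<close>

lemma has_crossing_sum_iff:
  fixes h1 h2 :: "real \<Rightarrow> real"
  assumes h1: "continuous_on UNIV h1" and a: "0 \<le> a" and b: "0 \<le> b"
  shows "has_crossing (\<lambda>x. h1 (fst x) + h2 (snd x)) 0 a b \<longleftrightarrow>
    (\<exists>y\<in>{0..b}. \<forall>x\<in>{0..a}. h1 x + h2 y \<le> 0)"
proof
  assume "has_crossing (\<lambda>x. h1 (fst x) + h2 (snd x)) 0 a b"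
  then obtain p where p: "path p" "path_image p \<subseteq> {x. h1 (fst x) + h2 (snd x) \<le> 0} \<inter> ({0..a} \<times> {0..b})"
    "path_image p \<inter> ({0} \<times> {0..b}) \<noteq> {}" "path_image p \<inter> ({a} \<times> {0..b}) \<noteq> {}"
    unfolding has_crossing_def by blast
  obtain x0 where x0: "x0 \<in> {0..a}" "\<And>x. x \<in> {0..a} \<Longrightarrow> h1 x \<le> h1 x0"
    using continuous_attains_sup[of "{0..a}" h1] a continuous_on_subset[OF h1 subset_UNIV, of "{0..a}"] by auto
  have conn: "connected (fst ` path_image p)"
    by (intro connected_continuous_image connected_path_image p(1) continuous_intros)
  obtain y1 where "(0, y1) \<in> path_image p" using p(3) by auto
  then have "0 \<in> fst ` path_image p" by force
  moreover obtain y2 where "(a, y2) \<in> path_image p" using p(4) by auto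
  then have "a \<in> fst ` path_image p" by force
  ultimately have "{0..a} \<subseteq> fst ` path_image p" using conn by (simp add: connected_contains_Icc)
  then obtain z where z: "z \<in> path_image p" "fst z = x0" using x0(1) by force
  with p(2) have "h1 x0 + h2 (snd z) \<le> 0" "snd z \<in> {0..b}" by auto
  with x0(2) show "\<exists>y\<in>{0..b}. \<forall>x\<in>{0..a}. h1 x + h2 y \<le> 0"
    by (intro bexI[of _ "snd z"] ballI) force+
next
  assume "\<exists>y\<in>{0..b}. \<forall>x\<in>{0..a}. h1 x + h2 y \<le> 0"
  then obtain y where y: "y \<in> {0..b}" "\<And>x. x \<in> {0..a} \<Longrightarrow> h1 x + h2 y \<le> 0" by blast
  have img: "\<exists>x\<in>{0..a}. z = (x, y)" if z: "z \<in> path_image (linepath (0, y) (a, y))" for z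
  proof -
    obtain t where t: "0 \<le> t" "t \<le> 1" "z = linepath (0, y) (a, y) t"
      using z by (auto simp: path_image_def)
    have "z = (t * a, y)"
      using t(3) by (simp add: linepath_def algebra_simps)
    moreover have "t * a \<in> {0..a}" using t a by (simp add: mult_left_le_one_le)
    ultimately show ?thesis by blast
  qed
  show "has_crossing (\<lambda>x. h1 (fst x) + h2 (snd x)) 0 a b"
    unfolding has_crossing_def
  proof (intro exI[of _ "linepath (0, y) (a, y)"] conjI)
    show "path_image (linepath (0, y) (a, y)) \<subseteq> {x. h1 (fst x) + h2 (snd x) \<le> 0} \<inter> ({0..a} \<times> {0..b})"
      using img y by fastforce
    have "(0, y) \<in> path_image (linepath (0, y) (a, y))"
      using pathstart_in_path_image[of "linepath (0, y) (a, y)"] by simp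
    then show "path_image (linepath (0, y) (a, y)) \<inter> ({0} \<times> {0..b}) \<noteq> {}" using y(1) by blast
    have "(a, y) \<in> path_image (linepath (0, y) (a, y))"
      using pathfinish_in_path_image[of "linepath (0, y) (a, y)"] by simp
    then show "path_image (linepath (0, y) (a, y)) \<inter> ({a} \<times> {0..b}) \<noteq> {}" using y(1) by blast
  qed simp
qed

text \<open>Comparing the maxima of \<open>h1\<close> and \<open>- h2\<close> by means of rational levels and rational arguments
exhibits the absence of a crossing as a countable combination of measurable events.\<close>

lemma not_crossing_iff_rational_level:
  fixes h1 h2 :: "real \<Rightarrow> real"
  assumes h: "continuous_on UNIV h1" "continuous_on UNIV h2" and a: "0 < a" and b: "0 < b"
  shows "\<not> has_crossing (\<lambda>x. h1 (fst x) + h2 (snd x)) 0 a b \<longleftrightarrow>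
    (\<exists>q\<in>\<rat>. (\<exists>x\<in>{0..a} \<inter> \<rat>. h1 x > q) \<and> \<not> (\<exists>y\<in>{0..b} \<inter> \<rat>. - h2 y > q))"
    (is "_ \<longleftrightarrow> ?R")
proof -
  have h2': "continuous_on UNIV (\<lambda>y. - h2 y)" using h(2) by (rule continuous_on_minus)
  have "(\<exists>y\<in>{0..b}. \<forall>x\<in>{0..a}. h1 x + h2 y \<le> 0) \<longleftrightarrow> \<not> ?R"
  proof
    assume "\<exists>y\<in>{0..b}. \<forall>x\<in>{0..a}. h1 x + h2 y \<le> 0"
    then obtain y where y: "y \<in> {0..b}" "\<And>x. x \<in> {0..a} \<Longrightarrow> h1 x + h2 y \<le> 0" by blast
    show "\<not> ?R"
    proof
      assume ?R
      then obtain q x where q: "x \<in> {0..a}" "h1 x > q" "\<not> (\<exists>y\<in>{0..b} \<inter> \<rat>. - h2 y > q)" by blast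
      then have "- h2 y > q" using y(2)[of x] by simp
      from continuous_exceeds_Rats[OF h2' b y(1) this] q(3) show False by blast
    qed
  next
    assume nR: "\<not> ?R"
    obtain x0 where x0: "x0 \<in> {0..a}" "\<And>x. x \<in> {0..a} \<Longrightarrow> h1 x \<le> h1 x0"
      using continuous_attains_sup[of "{0..a}" h1] a continuous_on_subset[OF h(1) subset_UNIV, of "{0..a}"] by auto
    obtain y0 where y0: "y0 \<in> {0..b}" "\<And>y. y \<in> {0..b} \<Longrightarrow> - h2 y \<le> - h2 y0"
      using continuous_attains_sup[of "{0..b}" "\<lambda>y. - h2 y"] b
        continuous_on_subset[OF h2' subset_UNIV, of "{0..b}"] by auto
    have "h1 x0 \<le> - h2 y0"
    proof (rule ccontr)
      assume "\<not> ?thesis"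
      then obtain q where q: "q \<in> \<rat>" "- h2 y0 < q" "q < h1 x0"
        using Rats_dense_in_real[of "- h2 y0" "h1 x0"] by auto
      have "\<exists>x\<in>{0..a} \<inter> \<rat>. h1 x > q" using continuous_exceeds_Rats[OF h(1) a x0(1) q(3)] .
      moreover have "\<not> (\<exists>y\<in>{0..b} \<inter> \<rat>. - h2 y > q)" using y0(2) q(2) by force
      ultimately show False using nR q(1) by blast
    qed
    then show "\<exists>y\<in>{0..b}. \<forall>x\<in>{0..a}. h1 x + h2 y \<le> 0"
      using x0(2) y0(1) by (intro bexI[of _ y0] ballI) force+
  qed
  then show ?thesis using has_crossing_sum_iff[OF h(1), of a b h2] a b by simp
qed

section \<open>Normalising a stationary Gaussian process\<close>

lemma (in prob_space) centred_gaussian_rv: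
  assumes W: "gaussian_rv M W" and mean: "expectation W = 0"
  shows "integrable M (\<lambda>\<omega>. (W \<omega>)\<^sup>2)"
    and "(CLINT \<omega>|M. iexp (W \<omega>)) = complex_of_real (exp (- expectation (\<lambda>\<omega>. (W \<omega>)\<^sup>2) / 2))"
proof -
  have [measurable]: "W \<in> borel_measurable M" using W by (simp add: gaussian_rv_def)
  obtain \<mu> where "(AE \<omega> in M. W \<omega> = \<mu>) \<or>
      (\<exists>\<sigma>>0. distributed M lborel W (\<lambda>x. ennreal (normal_density \<mu> \<sigma> x)))"
    using W unfolding gaussian_rv_def by blast
  then have "integrable M (\<lambda>\<omega>. (W \<omega>)\<^sup>2) \<and>
    (CLINT \<omega>|M. iexp (W \<omega>)) = complex_of_real (exp (- expectation (\<lambda>\<omega>. (W \<omega>)\<^sup>2) / 2))"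
  proof
    assume const: "AE \<omega> in M. W \<omega> = \<mu>"
    have "expectation W = expectation (\<lambda>_. \<mu>)"
      using const by (intro integral_cong_AE) auto
    then have "\<mu> = 0" using mean by (simp add: prob_space)
    with const have zero: "AE \<omega> in M. W \<omega> = 0" by simp
    have sq: "AE \<omega> in M. (W \<omega>)\<^sup>2 = 0" using zero by eventually_elim simp
    have "integrable M (\<lambda>\<omega>. (W \<omega>)\<^sup>2) = integrable M (\<lambda>\<omega>. 0 :: real)"
      using sq by (intro integrable_cong_AE) auto
    moreover have "expectation (\<lambda>\<omega>. (W \<omega>)\<^sup>2) = expectation (\<lambda>\<omega>. 0)"
      using sq by (intro integral_cong_AE) auto
    moreover have "(CLINT \<omega>|M. iexp (W \<omega>)) = (CLINT \<omega>|M. 1)"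
    proof (rule integral_cong_AE)
      show "AE \<omega> in M. iexp (W \<omega>) = 1" using zero by eventually_elim simp
    qed measurable
    ultimately show ?thesis by (simp add: prob_space)
  next
    assume "\<exists>\<sigma>>0. distributed M lborel W (\<lambda>x. ennreal (normal_density \<mu> \<sigma> x))"
    then obtain \<sigma> where \<sigma>: "0 < \<sigma>" and D: "distributed M lborel W (\<lambda>x. ennreal (normal_density \<mu> \<sigma> x))"
      by blast
    have \<mu>: "\<mu> = 0" using normal_distributed_expectation[OF \<sigma> D] mean by simp
    have int: "integrable M (\<lambda>\<omega>. (W \<omega>)\<^sup>2)"
      using distributed_integrable[OF D, of "\<lambda>x. x\<^sup>2"] integrable_normal_moment[OF \<sigma>, of 0 2] \<mu> by simp
    have var: "expectation (\<lambda>\<omega>. (W \<omega>)\<^sup>2) = \<sigma>\<^sup>2"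
      using normal_distributed_variance[OF \<sigma> D] mean by simp
    have "distributed M lborel (\<lambda>\<omega>. (W \<omega> - \<mu>) / \<sigma>) std_normal_density"
      using D normal_standard_normal_convert[OF \<sigma>] by simp
    then have law: "distr M lborel (\<lambda>\<omega>. W \<omega> / \<sigma>) = std_normal_distribution"
      using \<mu> by (simp add: distributed_distr_eq_density)
    have "(CLINT \<omega>|M. iexp (W \<omega>)) = (CLINT \<omega>|M. iexp (\<sigma> * (W \<omega> / \<sigma>)))" using \<sigma> by simp
    also have "\<dots> = (CLINT x|distr M lborel (\<lambda>\<omega>. W \<omega> / \<sigma>). iexp (\<sigma> * x))"
      by (subst integral_distr) auto
    also have "\<dots> = complex_of_real (exp (- \<sigma>\<^sup>2 / 2))"
      using char_std_normal_distribution unfolding law char_def by metis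
    finally show ?thesis using int var by simp
  qed
  then show "integrable M (\<lambda>\<omega>. (W \<omega>)\<^sup>2)"
    "(CLINT \<omega>|M. iexp (W \<omega>)) = complex_of_real (exp (- expectation (\<lambda>\<omega>. (W \<omega>)\<^sup>2) / 2))" by auto
qed

lemma gaussian_process_lincomb:
  assumes "gaussian_process M g"
  shows "gaussian_rv M (\<lambda>\<omega>. a * g s \<omega> + b * g t \<omega>)"
proof -
  have *: "gaussian_rv M (\<lambda>\<omega>. \<Sum>t\<in>T. c t * g t \<omega>)" if "finite T" for T c
    using assms that by (simp add: gaussian_process_def)
  show ?thesis
  proof (cases "s = t")
    case True
    then show ?thesis using *[of "{t}" "\<lambda>_. a + b"] by (simp add: distrib_right)
  next
    case False
    then show ?thesis using *[of "{s, t}" "\<lambda>x. if x = s then a else b"] by simp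
  qed
qed

lemma gaussian_process_measurable:
  assumes "gaussian_process M g"
  shows "g t \<in> borel_measurable M"
  using gaussian_process_lincomb[OF assms, of 1 t 0 t] by (simp add: gaussian_rv_def)

lemma measurable_sample_path:
  assumes "\<And>t. g t \<in> borel_measurable M"
  shows "(\<lambda>\<omega> t. g t \<omega>) \<in> M \<rightarrow>\<^sub>M path_space"
  using assms by (intro measurable_PiM_single') auto

lemma stationary_second_moment:
  assumes meas: "\<And>t. g t \<in> borel_measurable M" and stat: "stationary M g"
  shows "(\<integral>\<omega>. g s \<omega> * g t \<omega> \<partial>M) = cov_kernel M g (t - s)"
proof -
  have [measurable]: "(\<lambda>x. x 0 * x (t - s)) \<in> borel_measurable path_space"
    by (intro borel_measurable_times measurable_component_singleton) auto
  have law: "distr M path_space (\<lambda>\<omega> t. g (t + s) \<omega>) = distr M path_space (\<lambda>\<omega> t. g t \<omega>)"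
    using stat by (simp add: stationary_def process_law_def)
  have "(\<integral>\<omega>. g (0 + s) \<omega> * g ((t - s) + s) \<omega> \<partial>M)
      = (\<integral>x. x 0 * x (t - s) \<partial>distr M path_space (\<lambda>\<omega> t. g (t + s) \<omega>))"
    using measurable_sample_path[of "\<lambda>t. g (t + s)"] meas by (subst integral_distr) auto
  also have "\<dots> = (\<integral>\<omega>. g 0 \<omega> * g (t - s) \<omega> \<partial>M)"
    unfolding law using measurable_sample_path[OF meas] by (subst integral_distr) auto
  finally show ?thesis by (simp add: cov_kernel_def)
qed

lemma C2_smooth_imp:
  assumes "C2_smooth h"
  shows "continuous_on UNIV h" "\<exists>d. (h has_real_derivative d) (at t)"
  using assms unfolding C2_smooth_def
  by (meson DERIV_isCont continuous_at_imp_continuous_on, blast)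

locale smooth_stationary_gaussian = prob_space M for M :: "'w measure" +
  fixes g :: "real \<Rightarrow> 'w \<Rightarrow> real"
  assumes gaussian: "gaussian_process M g"
    and centred: "centred M g"
    and stationary: "stationary M g"
    and nonzero: "\<not> (AE \<omega> in M. \<forall>t. g t \<omega> = 0)"
    and smooth: "AE \<omega> in M. C2_smooth (\<lambda>t. g t \<omega>)"
    and decay: "((\<lambda>t. cov_kernel M g t * ln \<bar>t\<bar>) \<longlongrightarrow> 0) at_infinity"
begin

abbreviation K :: "real \<Rightarrow> real" where "K \<equiv> cov_kernel M g"

lemma measurable_g [measurable]: "g t \<in> borel_measurable M"
  using gaussian by (rule gaussian_process_measurable)

lemma expectation_g: "expectation (g t) = 0"
  using centred by (simp add: centred_def)

lemma second_moment: "expectation (\<lambda>\<omega>. g s \<omega> * g t \<omega>) = K (t - s)"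
  by (rule stationary_second_moment[OF measurable_g stationary])

lemma integrable_g_sq: "integrable M (\<lambda>\<omega>. (g t \<omega>)\<^sup>2)"
  using centred_gaussian_rv(1)[of "g t"] gaussian_process_lincomb[OF gaussian, of 1 t 0 t] expectation_g
  by simp

lemma integrable_g: "integrable M (g t)"
  using integrable_g_sq by (rule square_integrable_imp_integrable[rotated]) simp

lemma integrable_g_mult: "integrable M (\<lambda>\<omega>. g s \<omega> * g t \<omega>)"
proof (rule Bochner_Integration.integrable_bound)
  show "integrable M (\<lambda>\<omega>. (g s \<omega>)\<^sup>2 + (g t \<omega>)\<^sup>2)" using integrable_g_sq by simp
  have "\<bar>x * y\<bar> \<le> x\<^sup>2 + y\<^sup>2" for x y :: real
  proof -
    have "2 * \<bar>x * y\<bar> \<le> x\<^sup>2 + y\<^sup>2"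
      using sum_squares_bound[of "\<bar>x\<bar>" "\<bar>y\<bar>"] by (simp add: abs_mult)
    then show ?thesis using abs_ge_zero[of "x * y"] by linarith
  qed
  then show "AE \<omega> in M. norm (g s \<omega> * g t \<omega>) \<le> norm ((g s \<omega>)\<^sup>2 + (g t \<omega>)\<^sup>2)" by simp
qed measurable

text \<open>If the variance were \<open>0\<close>, almost surely all values at rational times, and by continuity all values,
would vanish.\<close>

lemma K_0_pos: "0 < K 0"
proof (rule ccontr)
  assume "\<not> 0 < K 0"
  moreover have "K 0 = expectation (\<lambda>\<omega>. (g 0 \<omega>)\<^sup>2)"
    using second_moment[of 0 0] by (simp add: power2_eq_square)
  moreover have "0 \<le> expectation (\<lambda>\<omega>. (g 0 \<omega>)\<^sup>2)" by simp
  ultimately have "K 0 = 0" by linarith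
  have "AE \<omega> in M. g t \<omega> = 0" for t
  proof -
    have "expectation (\<lambda>\<omega>. (g t \<omega>)\<^sup>2) = 0"
      using second_moment[of t t] \<open>K 0 = 0\<close> by (simp add: power2_eq_square)
    then have "AE \<omega> in M. (g t \<omega>)\<^sup>2 = 0"
      using integral_nonneg_eq_0_iff_AE[OF integrable_g_sq] by simp
    then show ?thesis by simp
  qed
  then have "AE \<omega> in M. \<forall>t\<in>\<rat>. g t \<omega> = 0"
    by (subst AE_ball_countable[OF countable_rat]) simp
  with smooth have "AE \<omega> in M. \<forall>t. g t \<omega> = 0"
  proof eventually_elim
    case (elim \<omega>)
    have "g t \<omega> = 0" for t
    proof -
      have "closed {t. g t \<omega> = 0}"
        using C2_smooth_imp(1)[OF elim(1)] by (intro closed_Collect_eq continuous_on_const)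
      moreover have "\<rat> \<subseteq> {t. g t \<omega> = 0}" using elim(2) by blast
      ultimately have "closure \<rat> \<subseteq> {t. g t \<omega> = 0}" by (rule closure_minimal[rotated])
      then show ?thesis using Rats_closure_real by blast
    qed
    then show ?case by blast
  qed
  with nonzero show False by blast
qed

text \<open>The sign \<open>e\<close> is needed because the second process enters the comparison of maxima as \<open>- g2\<close>.\<close>

lemma unit_gaussian_process_scaled:
  assumes e: "e\<^sup>2 = 1"
  shows "unit_gaussian_process M (\<lambda>t \<omega>. e * g t \<omega> / sqrt (K 0)) (\<lambda>t. K t / K 0)"
proof (intro unit_gaussian_process.intro unit_gaussian_process_axioms.intro)
  show "prob_space M" by (rule prob_space_axioms)
  define c where "c = e / sqrt (K 0)"
  have c2: "c\<^sup>2 = 1 / K 0" using e K_0_pos by (simp add: c_def power_divide)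
  have eq: "e * x / sqrt (K 0) = c * x" for x by (simp add: c_def)
  have cc: "c * x * (c * y) = (1 / K 0) * (x * y)" for x y
    unfolding c2[symmetric] by (simp add: power2_eq_square)
  show "(\<lambda>\<omega>. e * g t \<omega> / sqrt (K 0)) \<in> borel_measurable M" for t by measurable
  show "integrable M (\<lambda>\<omega>. e * g s \<omega> / sqrt (K 0) * (e * g t \<omega> / sqrt (K 0)))" for s t
    unfolding eq cc by (intro integrable_mult_right integrable_g_mult)
  show "expectation (\<lambda>\<omega>. e * g s \<omega> / sqrt (K 0) * (e * g t \<omega> / sqrt (K 0))) = K (t - s) / K 0" for s t
    unfolding eq cc by (simp add: second_moment)
  show "(CLINT \<omega>|M. iexp (a * (e * g s \<omega> / sqrt (K 0)) + b * (e * g t \<omega> / sqrt (K 0)))) =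
      complex_of_real (exp (- (a\<^sup>2 + b\<^sup>2 + 2 * a * b * (K (t - s) / K 0)) / 2))" for a b s t
  proof -
    let ?W = "\<lambda>\<omega>. (a * c) * g s \<omega> + (b * c) * g t \<omega>"
    have "expectation ?W = 0" using integrable_g expectation_g by simp
    note W = centred_gaussian_rv(2)[OF gaussian_process_lincomb[OF gaussian] this]
    have "(?W \<omega>)\<^sup>2 = c\<^sup>2 * (a\<^sup>2 * (g s \<omega> * g s \<omega>) + b\<^sup>2 * (g t \<omega> * g t \<omega>) + 2 * a * b * (g s \<omega> * g t \<omega>))" for \<omega>
      by (simp add: power2_eq_square algebra_simps)
    then have "expectation (\<lambda>\<omega>. (?W \<omega>)\<^sup>2) = c\<^sup>2 * (a\<^sup>2 * K 0 + b\<^sup>2 * K 0 + 2 * a * b * K (t - s))"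
      using integrable_g_mult by (simp add: second_moment)
    also have "\<dots> = a\<^sup>2 + b\<^sup>2 + 2 * a * b * (K (t - s) / K 0)"
      unfolding c2 using K_0_pos by (simp add: field_simps)
    finally have "expectation (\<lambda>\<omega>. (?W \<omega>)\<^sup>2) = a\<^sup>2 + b\<^sup>2 + 2 * a * b * (K (t - s) / K 0)" .
    with W show ?thesis by (simp only: eq mult.assoc)
  qed
  show "AE \<omega> in M. continuous_on UNIV (\<lambda>t. e * g t \<omega> / sqrt (K 0))"
    using smooth unfolding eq
    by eventually_elim (rule continuous_on_mult_left[OF C2_smooth_imp(1)])
  show "AE \<omega> in M. \<exists>d. ((\<lambda>t. e * g t \<omega> / sqrt (K 0)) has_real_derivative d) (at 0)"
    using smooth unfolding eq
  proof eventually_elim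
    case (elim \<omega>)
    from C2_smooth_imp(2)[OF this, of 0]
    obtain d where "((\<lambda>t. g t \<omega>) has_real_derivative d) (at 0)" ..
    from DERIV_cmult[OF this, of c] show ?case ..
  qed
  have "((\<lambda>t. (1 / K 0) * (K t * ln \<bar>t\<bar>)) \<longlongrightarrow> (1 / K 0) * 0) at_infinity"
    by (intro tendsto_mult_left decay)
  then show "((\<lambda>t. K t / K 0 * ln \<bar>t\<bar>) \<longlongrightarrow> 0) at_infinity" by simp
qed

end

section \<open>Crossing probabilities\<close>

lemma exceeds_scale:
  assumes "0 < s"
  shows "exceeds M (\<lambda>t \<omega>. Y t \<omega> / s) (u / s) R = exceeds M Y u R"
  using assms by (simp add: exceeds_def divide_less_cancel)

lemma (in prob_space) prob_exceeds_indep: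
  assumes indep: "indep_processes M g1 g2"
    and meas: "\<And>t. g1 t \<in> borel_measurable M" "\<And>t. g2 t \<in> borel_measurable M"
  shows "prob (exceeds M g1 u a \<inter> exceeds M (\<lambda>t \<omega>. - g2 t \<omega>) v b)
    = prob (exceeds M g1 u a) * prob (exceeds M (\<lambda>t \<omega>. - g2 t \<omega>) v b)"
proof -
  define A where "A = exceeds path_space (\<lambda>t x. x t) u a"
  define B where "B = exceeds path_space (\<lambda>t x. - x t) v b"
  have "A \<in> sets path_space" unfolding A_def
    by (intro sets_exceeds measurable_component_singleton) auto
  moreover have "B \<in> sets path_space" unfolding B_def
    by (intro sets_exceeds borel_measurable_uminus measurable_component_singleton) auto
  ultimately have *: "prob ((\<lambda>\<omega>. ((\<lambda>t. g1 t \<omega>), (\<lambda>t. g2 t \<omega>))) -` (A \<times> B) \<inter> space M) =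
      prob ((\<lambda>\<omega> t. g1 t \<omega>) -` A \<inter> space M) * prob ((\<lambda>\<omega> t. g2 t \<omega>) -` B \<inter> space M)"
    using indep unfolding indep_processes_def by (intro indep_varD)
  have 1: "(\<lambda>\<omega> t. g1 t \<omega>) -` A \<inter> space M = exceeds M g1 u a"
    by (auto simp: A_def exceeds_def space_PiM)
  have 2: "(\<lambda>\<omega> t. g2 t \<omega>) -` B \<inter> space M = exceeds M (\<lambda>t \<omega>. - g2 t \<omega>) v b"
    by (auto simp: B_def exceeds_def space_PiM)
  have 3: "(\<lambda>\<omega>. ((\<lambda>t. g1 t \<omega>), (\<lambda>t. g2 t \<omega>))) -` (A \<times> B) \<inter> space M =
      exceeds M g1 u a \<inter> exceeds M (\<lambda>t \<omega>. - g2 t \<omega>) v b"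
    unfolding 1[symmetric] 2[symmetric] by auto
  show ?thesis using * unfolding 1 2 3 .
qed

text \<open>If \<open>- g2\<close> exceeds some level and \<open>g1\<close> does not, there is a crossing; if \<open>g1\<close> exceeds it and \<open>- g2\<close> does
not, there is none. Independence turns both inclusions into products. The set \<open>N\<close> below is a
measurable version of the complement of the crossing event.\<close>

lemma (in prob_space) cross_prob_bounds:
  assumes indep: "indep_processes M g1 g2"
    and meas: "\<And>t. g1 t \<in> borel_measurable M" "\<And>t. g2 t \<in> borel_measurable M"
    and cont: "AE \<omega> in M. continuous_on UNIV (\<lambda>t. g1 t \<omega>)" "AE \<omega> in M. continuous_on UNIV (\<lambda>t. g2 t \<omega>)"
    and ab: "0 < a" "0 < b"
  shows "prob (exceeds M (\<lambda>t \<omega>. - g2 t \<omega>) u b) * (1 - prob (exceeds M g1 u a))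
      \<le> cross_prob M (sum_field g1 g2) 0 a b" (is ?lower)
    and "cross_prob M (sum_field g1 g2) 0 a b
      \<le> 1 - prob (exceeds M g1 u a) * (1 - prob (exceeds M (\<lambda>t \<omega>. - g2 t \<omega>) u b))" (is ?upper)
proof -
  define E1 where "E1 q = exceeds M g1 q a" for q
  define E2 where "E2 q = exceeds M (\<lambda>t \<omega>. - g2 t \<omega>) q b" for q
  have E [measurable]: "E1 q \<in> events" "E2 q \<in> events" for q
    unfolding E1_def E2_def using meas by (intro sets_exceeds borel_measurable_uminus; simp)+
  define N where "N = (\<Union>q\<in>\<rat>. E1 q - E2 q)"
  have [measurable]: "N \<in> events"
    unfolding N_def by (rule sets.countable_UN''[OF countable_rat]) measurable
  have "AE \<omega> in M. \<omega> \<in> Cross M (sum_field g1 g2) 0 a b \<longleftrightarrow> \<omega> \<in> space M - N"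
    using cont AE_space
  proof eventually_elim
    case (elim \<omega>)
    have "\<omega> \<in> N \<longleftrightarrow> \<not> has_crossing (\<lambda>x. g1 (fst x) \<omega> + g2 (snd x) \<omega>) 0 a b"
      unfolding not_crossing_iff_rational_level[OF elim(1,2) ab] N_def E1_def E2_def exceeds_def
      using elim(3) by blast
    then show ?case using elim(3) by (simp add: Cross_def sum_field_def)
  qed
  then have ae: "AE \<omega> in completion M. \<omega> \<in> space M - N \<longleftrightarrow> \<omega> \<in> Cross M (sum_field g1 g2) 0 a b"
    by (intro AE_completion) (auto elim: eventually_mono)
  interpret completion: complete_measure "completion M" by unfold_locales
  have "Cross M (sum_field g1 g2) 0 a b \<in> sets (completion M)"
    by (rule completion.in_sets_AE[OF ae]) (auto simp: Cross_def)
  then have "measure (completion M) (Cross M (sum_field g1 g2) 0 a b) = measure (completion M) (space M - N)"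
    using ae by (intro measure_eq_AE) auto
  also have "\<dots> = prob (space M - N)" by (intro measure_completion) measurable
  also have "\<dots> = 1 - prob N" by (rule prob_compl) measurable
  finally have cross: "cross_prob M (sum_field g1 g2) 0 a b = 1 - prob N" by (simp add: cross_prob_def)
  have indep': "prob (E1 u \<inter> E2 u) = prob (E1 u) * prob (E2 u)"
    unfolding E1_def E2_def by (rule prob_exceeds_indep[OF indep meas])
  have "E1 u - E2 u \<subseteq> N"
  proof
    fix \<omega> assume \<omega>: "\<omega> \<in> E1 u - E2 u"
    then obtain t where t: "t \<in> {0..a} \<inter> \<rat>" "g1 t \<omega> > u" "\<omega> \<in> space M" by (auto simp: E1_def exceeds_def)
    obtain q where q: "q \<in> \<rat>" "u < q" "q < g1 t \<omega>" using Rats_dense_in_real[OF t(2)] by blast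
    have "\<omega> \<in> E1 q" using t q by (auto simp: E1_def exceeds_def)
    moreover have "\<omega> \<notin> E2 q"
    proof
      assume "\<omega> \<in> E2 q"
      then have "\<omega> \<in> E2 u" using q(2) by (force simp: E2_def exceeds_def)
      with \<omega> show False by blast
    qed
    ultimately show "\<omega> \<in> N" using q(1) by (auto simp: N_def)
  qed
  then have "prob (E1 u - E2 u) \<le> prob N" by (rule finite_measure_mono) measurable
  moreover have "prob (E1 u - E2 u) = prob (E1 u) - prob (E1 u \<inter> E2 u)"
    by (rule finite_measure_Diff') measurable
  ultimately show ?upper unfolding cross indep' E1_def[symmetric] E2_def[symmetric]
    by (simp add: algebra_simps)
  have "(E2 u - E1 u) \<inter> N = {}"
    by (force simp: N_def E1_def E2_def exceeds_def)
  then have "E2 u - E1 u \<subseteq> space M - N" using sets.sets_into_space[OF E(2)[of u]] by blast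
  then have "prob (E2 u - E1 u) \<le> prob (space M - N)" by (rule finite_measure_mono) measurable
  moreover have "prob (space M - N) = 1 - prob N" by (rule prob_compl) measurable
  moreover have "prob (E2 u - E1 u) = prob (E2 u) - prob (E2 u \<inter> E1 u)"
    by (rule finite_measure_Diff') measurable
  ultimately show ?lower unfolding cross using indep' unfolding E1_def[symmetric] E2_def[symmetric]
    by (simp add: algebra_simps Int_commute)
qed

theorem theorem1p8:
  fixes M :: "'w measure"
    and g1 g2 :: "real \<Rightarrow> 'w \<Rightarrow> real"
    and K1 K2 :: "real \<Rightarrow> real"
    and f :: "real \<times> real \<Rightarrow> 'w \<Rightarrow> real"
  assumes "prob_space M"
    and "indep_processes M g1 g2"
    and "gaussian_process M g1" and "gaussian_process M g2"
    and "centred M g1" and "centred M g2"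
    and "stationary M g1" and "stationary M g2"
    and K1_def: "K1 = cov_kernel M g1" and K2_def: "K2 = cov_kernel M g2"
    and "\<not> (AE \<omega> in M. \<forall>t. g1 t \<omega> = 0)" and "\<not> (AE \<omega> in M. \<forall>t. g2 t \<omega> = 0)"
    and "AE \<omega> in M. C2_smooth (\<lambda>t. g1 t \<omega>)" and "AE \<omega> in M. C2_smooth (\<lambda>t. g2 t \<omega>)"
    and "((\<lambda>t. K1 t * ln \<bar>t\<bar>) \<longlongrightarrow> 0) at_infinity"
    and "((\<lambda>t. K2 t * ln \<bar>t\<bar>) \<longlongrightarrow> 0) at_infinity"
    and f_def: "f = sum_field g1 g2"
  shows
    "((\<forall>\<rho>>0. 0 < Liminf at_top (\<lambda>R::real. ereal (cross_prob M f 0 R (\<rho> * R))) \<and>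
        Liminf at_top (\<lambda>R::real. ereal (cross_prob M f 0 R (\<rho> * R)))
          \<le> Limsup at_top (\<lambda>R::real. ereal (cross_prob M f 0 R (\<rho> * R))) \<and>
        Limsup at_top (\<lambda>R::real. ereal (cross_prob M f 0 R (\<rho> * R))) < 1)
      \<longleftrightarrow> K1 0 = K2 0) \<and>
     (K1 0 \<noteq> K2 0 \<longrightarrow>
       (\<forall>\<rho>>0. ((\<lambda>R::real. cross_prob M f 0 R (\<rho> * R)) \<longlongrightarrow>
                  (if K1 0 < K2 0 then 1 else 0)) at_top))"
proof -
  interpret prob_space M by fact
  interpret G1: smooth_stationary_gaussian M g1
    by unfold_locales (use assms in auto)
  interpret G2: smooth_stationary_gaussian M g2
    by unfold_locales (use assms in auto)
  define \<sigma>1 where "\<sigma>1 = sqrt (K1 0)"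
  define \<sigma>2 where "\<sigma>2 = sqrt (K2 0)"
  have \<sigma>: "0 < \<sigma>1" "0 < \<sigma>2"
    using G1.K_0_pos G2.K_0_pos by (auto simp: \<sigma>1_def \<sigma>2_def K1_def K2_def)
  interpret X1: unit_gaussian_process M "\<lambda>t \<omega>. 1 * g1 t \<omega> / sqrt (cov_kernel M g1 0)" "\<lambda>t. cov_kernel M g1 t / cov_kernel M g1 0"
    by (rule G1.unit_gaussian_process_scaled) simp
  interpret X2: unit_gaussian_process M "\<lambda>t \<omega>. (-1) * g2 t \<omega> / sqrt (cov_kernel M g2 0)" "\<lambda>t. cov_kernel M g2 t / cov_kernel M g2 0"
    by (rule G2.unit_gaussian_process_scaled) simp
  define P1 where "P1 v R = prob (exceeds M (\<lambda>t \<omega>. 1 * g1 t \<omega> / sqrt (cov_kernel M g1 0)) v R)" for v R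
  define P2 where "P2 v R = prob (exceeds M (\<lambda>t \<omega>. (-1) * g2 t \<omega> / sqrt (cov_kernel M g2 0)) v R)" for v R
  have P1: "prob (exceeds M g1 u R) = P1 (u / \<sigma>1) R" for u R
    using exceeds_scale[OF \<sigma>(1), of M g1 u R] by (simp add: P1_def \<sigma>1_def K1_def)
  have P2: "prob (exceeds M (\<lambda>t \<omega>. - g2 t \<omega>) u R) = P2 (u / \<sigma>2) R" for u R
    using exceeds_scale[OF \<sigma>(2), of M "\<lambda>t \<omega>. - g2 t \<omega>" u R] by (simp add: P2_def \<sigma>2_def K2_def)
  obtain D1 v1 where D1: "0 < D1" "\<And>v R. v1 \<le> v \<Longrightarrow> 0 \<le> R \<Longrightarrow> P1 v R \<le> D1 * ((R + 1) * exp (- v\<^sup>2 / 2))"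
    unfolding P1_def by (rule X1.prob_exceeds_le) blast
  obtain D2 v2 where D2: "0 < D2" "\<And>v R. v2 \<le> v \<Longrightarrow> 0 \<le> R \<Longrightarrow> P2 v R \<le> D2 * ((R + 1) * exp (- v\<^sup>2 / 2))"
    unfolding P2_def by (rule X2.prob_exceeds_le) blast
  obtain C1 where C1: "0 < C1" "\<And>\<epsilon>. 0 < \<epsilon> \<Longrightarrow> \<forall>\<^sub>F v in at_top. \<forall>R>0.
      R * exp (- v\<^sup>2 / 2) / (C1 + (1 + \<epsilon>) * (R * exp (- v\<^sup>2 / 2))) \<le> P1 v R"
    unfolding P1_def by (rule X1.prob_exceeds_ge) blast
  obtain C2 where C2: "0 < C2" "\<And>\<epsilon>. 0 < \<epsilon> \<Longrightarrow> \<forall>\<^sub>F v in at_top. \<forall>R>0.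
      R * exp (- v\<^sup>2 / 2) / (C2 + (1 + \<epsilon>) * (R * exp (- v\<^sup>2 / 2))) \<le> P2 v R"
    unfolding P2_def by (rule X2.prob_exceeds_ge) blast
  define p where "p \<rho> R = cross_prob M f 0 R (\<rho> * R)" for \<rho> R :: real
  have cont: "AE \<omega> in M. continuous_on UNIV (\<lambda>t. g1 t \<omega>)" "AE \<omega> in M. continuous_on UNIV (\<lambda>t. g2 t \<omega>)"
    using eventually_mono[OF G1.smooth C2_smooth_imp(1)] eventually_mono[OF G2.smooth C2_smooth_imp(1)]
    by simp_all
  have p_ge: "P2 (u / \<sigma>2) (\<rho> * R) * (1 - P1 (u / \<sigma>1) R) \<le> p \<rho> R"
    and p_le: "p \<rho> R \<le> 1 - P1 (u / \<sigma>1) R * (1 - P2 (u / \<sigma>2) (\<rho> * R))"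
    if "0 < \<rho>" "0 < R" for u \<rho> R
    using cross_prob_bounds[OF assms(2) G1.measurable_g G2.measurable_g cont, of R "\<rho> * R" u] that
    unfolding P1 P2 p_def f_def by auto
  have p_01: "0 \<le> p \<rho> R" "p \<rho> R \<le> 1" if "0 < \<rho>" "0 < R" for \<rho> R
  proof -
    show "0 \<le> p \<rho> R" by (simp add: p_def cross_prob_def)
    have "0 \<le> P1 0 R * (1 - P2 0 (\<rho> * R))" by (simp add: P1_def P2_def)
    then show "p \<rho> R \<le> 1" using p_le[OF that, of 0] by simp
  qed
  have pos: "\<forall>\<^sub>F R::real in at_top. 0 < R" by (rule eventually_gt_at_top)
  have balanced: "0 < Liminf at_top (\<lambda>R. ereal (p \<rho> R)) \<and>
      Liminf at_top (\<lambda>R. ereal (p \<rho> R)) \<le> Limsup at_top (\<lambda>R. ereal (p \<rho> R)) \<and>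
      Limsup at_top (\<lambda>R. ereal (p \<rho> R)) < 1" if eq: "K1 0 = K2 0" and \<rho>: "0 < \<rho>" for \<rho>
  proof (intro conjI)
    have \<sigma>_eq: "\<sigma>1 = \<sigma>2" using eq by (simp add: \<sigma>1_def \<sigma>2_def)
    have level: "v * \<sigma>1 / \<sigma>1 = v" "v * \<sigma>1 / \<sigma>2 = v" for v using \<sigma> \<sigma>_eq by auto
    obtain c where c: "0 < c" "\<forall>\<^sub>F R in at_top. \<exists>v. c \<le> P2 v (\<rho> * R) * (1 - P1 v (1 * R))"
      using eventually_balanced_level[OF D1 C2 zero_less_one \<rho>] by blast
    have "\<forall>\<^sub>F R in at_top. ereal c \<le> ereal (p \<rho> R)"
      using c(2) pos
    proof eventually_elim
      case (elim R)
      then obtain v where "c \<le> P2 v (\<rho> * R) * (1 - P1 v R)" by auto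
      also have "\<dots> \<le> p \<rho> R" using p_ge[OF \<rho> elim(2), of "v * \<sigma>1"] unfolding level .
      finally show ?case by simp
    qed
    then have "ereal c \<le> Liminf at_top (\<lambda>R. ereal (p \<rho> R))" by (rule Liminf_bounded)
    then show "0 < Liminf at_top (\<lambda>R. ereal (p \<rho> R))" using c(1) by (auto intro: less_le_trans[of _ "ereal c"])
    show "Liminf at_top (\<lambda>R. ereal (p \<rho> R)) \<le> Limsup at_top (\<lambda>R. ereal (p \<rho> R))"
      by (rule Liminf_le_Limsup) simp
    obtain d where d: "0 < d" "\<forall>\<^sub>F R in at_top. \<exists>v. d \<le> P1 v (1 * R) * (1 - P2 v (\<rho> * R))"
      using eventually_balanced_level[OF D2 C1 \<rho> zero_less_one] by blast
    have "\<forall>\<^sub>F R in at_top. ereal (p \<rho> R) \<le> ereal (1 - d)"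
      using d(2) pos
    proof eventually_elim
      case (elim R)
      then obtain v where "d \<le> P1 v R * (1 - P2 v (\<rho> * R))" by auto
      moreover have "p \<rho> R \<le> 1 - P1 v R * (1 - P2 v (\<rho> * R))"
        using p_le[OF \<rho> elim(2), of "v * \<sigma>1"] unfolding level .
      ultimately show ?case by simp
    qed
    then have "Limsup at_top (\<lambda>R. ereal (p \<rho> R)) \<le> ereal (1 - d)" by (rule Limsup_bounded)
    then show "Limsup at_top (\<lambda>R. ereal (p \<rho> R)) < 1" using d(1) by (auto intro: le_less_trans[of _ "ereal (1 - d)"])
  qed
  have limit: "(p \<rho> \<longlongrightarrow> (if K1 0 < K2 0 then 1 else 0)) at_top" if ne: "K1 0 \<noteq> K2 0" and \<rho>: "0 < \<rho>" for \<rho>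
  proof (cases "K1 0 < K2 0")
    case True
    then have less: "\<sigma>1 < \<sigma>2" by (simp add: \<sigma>1_def \<sigma>2_def)
    have "(p \<rho> \<longlongrightarrow> 1) at_top"
    proof (rule order_tendstoI)
      fix l :: real assume "l < 1"
      define \<delta> where "\<delta> = min (1 / 2) ((1 - l) / 2)"
      have \<delta>: "0 < \<delta>" "\<delta> < 1" "l < 1 - \<delta>" using \<open>l < 1\<close> by (auto simp: \<delta>_def min_def field_simps)
      have "\<forall>\<^sub>F R in at_top. \<exists>u. 1 - \<delta> \<le> P2 (u / \<sigma>2) (\<rho> * R) * (1 - P1 (u / \<sigma>1) (1 * R))"
        by (rule eventually_separating_level[OF D1 C2 zero_less_one \<rho> \<sigma>(1) less \<delta>(1,2)])
      then show "\<forall>\<^sub>F R in at_top. l < p \<rho> R"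
        using pos
      proof eventually_elim
        case (elim R)
        then obtain u where "1 - \<delta> \<le> P2 (u / \<sigma>2) (\<rho> * R) * (1 - P1 (u / \<sigma>1) R)" by auto
        with p_ge[OF \<rho> elim(2), of u] \<delta>(3) show ?case by linarith
      qed
    next
      fix l :: real assume "1 < l"
      show "\<forall>\<^sub>F R in at_top. p \<rho> R < l"
        using pos by eventually_elim (rule le_less_trans[OF p_01(2)[OF \<rho>] \<open>1 < l\<close>])
    qed
    with True show ?thesis by simp
  next
    case False
    with ne have less: "\<sigma>2 < \<sigma>1" by (simp add: \<sigma>1_def \<sigma>2_def)
    have "(p \<rho> \<longlongrightarrow> 0) at_top"
    proof (rule order_tendstoI)
      fix l :: real assume "0 < l"
      define \<delta> where "\<delta> = min (1 / 2) (l / 2)"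
      have \<delta>: "0 < \<delta>" "\<delta> < 1" "\<delta> < l" using \<open>0 < l\<close> by (auto simp: \<delta>_def min_def)
      have "\<forall>\<^sub>F R in at_top. \<exists>u. 1 - \<delta> \<le> P1 (u / \<sigma>1) (1 * R) * (1 - P2 (u / \<sigma>2) (\<rho> * R))"
        by (rule eventually_separating_level[OF D2 C1 \<rho> zero_less_one \<sigma>(2) less \<delta>(1,2)])
      then show "\<forall>\<^sub>F R in at_top. p \<rho> R < l"
        using pos
      proof eventually_elim
        case (elim R)
        then obtain u where "1 - \<delta> \<le> P1 (u / \<sigma>1) R * (1 - P2 (u / \<sigma>2) (\<rho> * R))" by auto
        with p_le[OF \<rho> elim(2), of u] \<delta>(3) show ?case by linarith
      qed
    next
      fix l :: real assume "l < 0"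
      show "\<forall>\<^sub>F R in at_top. l < p \<rho> R"
        using pos by eventually_elim (rule less_le_trans[OF \<open>l < 0\<close> p_01(1)[OF \<rho>]])
    qed
    with False show ?thesis by simp
  qed
  have degenerate: "\<not> (0 < Liminf at_top (\<lambda>R. ereal (p 1 R)) \<and> Limsup at_top (\<lambda>R. ereal (p 1 R)) < 1)"
    if ne: "K1 0 \<noteq> K2 0"
  proof -
    have "((\<lambda>R. ereal (p 1 R)) \<longlongrightarrow> ereal (if K1 0 < K2 0 then 1 else 0)) at_top"
      using limit[OF ne, of 1] by (intro tendsto_ereal) auto
    then have "Liminf at_top (\<lambda>R. ereal (p 1 R)) = ereal (if K1 0 < K2 0 then 1 else 0)"
      "Limsup at_top (\<lambda>R. ereal (p 1 R)) = ereal (if K1 0 < K2 0 then 1 else 0)"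
      by (auto intro!: lim_imp_Liminf lim_imp_Limsup)
    then show ?thesis by simp
  qed
  show ?thesis
    using balanced limit degenerate unfolding p_def[symmetric] by (metis zero_less_one)
qed

end
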